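(* Let $\operatorname{char}K=2$ and let $\mathbf R$ be the Lie algebra generated by $\{v_0,v_1\}$ (using the bracket only). Then, with respect to the $\mathbb N$-gradation $\mathbf R=\bigoplus_{n\ge1}\mathbf R_n$ by degree in $\{v_0,v_1\}$, $\mathbf R$ is of width $2$ but it is not thin.
   Context: Let $\Lambda=\Lambda(x_i\mid i\ge 0)$ be the Grassmann (exterior) algebra over a field $K$ of characteristic $2$ on generators $x_0,x_1,\dots$ ($x_ix_j=x_jx_i$, $x_i^2=0$). In $\operatorname{End}\Lambda$ identify $x_i$ with left multiplication by $x_i$, and let $\partial_i$ be the derivation of $\Lambda$ with $\partial_i(x_j)=\delta_{ij}$. The pivot elements are $v_i=\partial_i+x_ix_{i+1}(\partial_{i+2}+x_{i+2}x_{i+3}(\partial_{i+4}+\cdots))$, $i\ge 0$, that is, $v_i=\partial_i+x_ix_{i+1}v_{i+2}$ (well defined on $\Lambda$, since each element involves finitely many letters). $\mathbf R$ is the smallest subspace of $\operatorname{End}\Lambda$ containing $v_0,v_1$ and closed under $[a,b]=ab+ba$; $\mathbf R_n$ is spanned by commutators of length $n$ in $v_0,v_1$. A graded Lie algebra $L=\bigoplus_{n\ge1}L_n$ is of width $d$ if $\dim L_n\le d$ for all $n\ge1$ and $d$ is minimal with this property. It is thin if $\dim L_1=2$ and it satisfies the covering property: $L_{n+1}=[L_1,z]$ for every $0\ne z\in L_n$ and all $n\ge 1$. *)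

theory Defs
  imports
    "HOL-Library.Function_Algebras"
    "HOL-Library.Groups_Big_Fun"
    "HOL-Computational_Algebra.Computational_Algebra"
begin

section \<open>The Grassmann algebra in characteristic 2\<close>

text \<open>
  An element is given by its coefficients on the monomials \<open>x\<^sub>A = \<Prod>i\<in>A. x\<^sub>i\<close>, with \<open>A\<close> a finite
  set of indices, and \<open>x\<^sub>A x\<^sub>B\<close> is \<open>x\<^bsub>A \<union> B\<^esub>\<close> if \<open>A\<close> and \<open>B\<close> are disjoint and \<open>0\<close> otherwise.
  There are no signs, so this is the exterior algebra only for ground fields of characteristic 2.
\<close>

typedef (overloaded) 'k grassmann =
  "{f :: nat set \<Rightarrow> 'k::field. finite {A. f A \<noteq> 0} \<and> (\<forall>A. f A \<noteq> 0 \<longrightarrow> finite A)}"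
  morphisms coeff_of Abs_grassmann
  by (rule exI[of _ "\<lambda>_. 0"]) auto

setup_lifting type_definition_grassmann

lemma grassmann_eqI: "(\<And>A. finite A \<Longrightarrow> coeff_of f A = coeff_of g A) \<Longrightarrow> f = g"
proof (transfer, rule ext)
  fix f g :: "nat set \<Rightarrow> 'a" and A
  assume a: "finite {A. f A \<noteq> 0} \<and> (\<forall>A. f A \<noteq> 0 \<longrightarrow> finite A)"
    "finite {A. g A \<noteq> 0} \<and> (\<forall>A. g A \<noteq> 0 \<longrightarrow> finite A)" "\<And>A. finite A \<Longrightarrow> f A = g A"
  show "f A = g A" using a by (cases "finite A") metis+
qed

instantiation grassmann :: (field) comm_ring_1
begin

lift_definition zero_grassmann :: "'a grassmann" is "\<lambda>_. 0" by simp

lift_definition one_grassmann :: "'a grassmann" is "\<lambda>A. if A = {} then 1 else 0" by simp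

lift_definition plus_grassmann :: "'a grassmann \<Rightarrow> 'a grassmann \<Rightarrow> 'a grassmann"
  is "\<lambda>f g A. f A + g A"
proof (intro conjI allI impI)
  fix f g :: "nat set \<Rightarrow> 'a"
  assume f: "finite {A. f A \<noteq> 0} \<and> (\<forall>A. f A \<noteq> 0 \<longrightarrow> finite A)"
    and g: "finite {A. g A \<noteq> 0} \<and> (\<forall>A. g A \<noteq> 0 \<longrightarrow> finite A)"
  show "finite {A. f A + g A \<noteq> 0}"
    by (rule finite_subset[of _ "{A. f A \<noteq> 0} \<union> {A. g A \<noteq> 0}"]) (use f g in auto)
  show "finite A" if "f A + g A \<noteq> 0" for A
  proof (cases "f A = 0")
    case True
    then have "g A \<noteq> 0" using that by simp
    then show ?thesis using g by blast
  next
    case False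
    then show ?thesis using f by blast
  qed
qed

lift_definition uminus_grassmann :: "'a grassmann \<Rightarrow> 'a grassmann" is "\<lambda>f A. - f A" by simp

definition minus_grassmann :: "'a grassmann \<Rightarrow> 'a grassmann \<Rightarrow> 'a grassmann"
  where "f - g = f + - (g :: 'a grassmann)"

lift_definition times_grassmann :: "'a grassmann \<Rightarrow> 'a grassmann \<Rightarrow> 'a grassmann"
  is "\<lambda>f g A. \<Sum>B\<in>Pow A. f B * g (A - B)"
proof (intro conjI allI impI)
  fix f g :: "nat set \<Rightarrow> 'a"
  assume f: "finite {A. f A \<noteq> 0} \<and> (\<forall>A. f A \<noteq> 0 \<longrightarrow> finite A)"
    and g: "finite {A. g A \<noteq> 0} \<and> (\<forall>A. g A \<noteq> 0 \<longrightarrow> finite A)"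
  have ex: "\<exists>B. B \<subseteq> A \<and> f B \<noteq> 0 \<and> g (A - B) \<noteq> 0" if nz: "(\<Sum>B\<in>Pow A. f B * g (A - B)) \<noteq> 0" for A
  proof -
    obtain B where "B \<in> Pow A" "f B * g (A - B) \<noteq> 0"
      by (rule sum.not_neutral_contains_not_neutral[OF nz])
    then have "B \<subseteq> A \<and> f B \<noteq> 0 \<and> g (A - B) \<noteq> 0" by simp
    then show ?thesis by (rule exI)
  qed
  show "finite {A. (\<Sum>B\<in>Pow A. f B * g (A - B)) \<noteq> 0}"
  proof (rule finite_subset)
    show "{A. (\<Sum>B\<in>Pow A. f B * g (A - B)) \<noteq> 0}
      \<subseteq> (\<lambda>(B, C). B \<union> C) ` ({A. f A \<noteq> 0} \<times> {A. g A \<noteq> 0})"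
    proof
      fix A assume "A \<in> {A. (\<Sum>B\<in>Pow A. f B * g (A - B)) \<noteq> 0}"
      then obtain B where B: "B \<subseteq> A" "f B \<noteq> 0" "g (A - B) \<noteq> 0" using ex by blast
      then have "A = (\<lambda>(B, C). B \<union> C) (B, A - B)" by auto
      then show "A \<in> (\<lambda>(B, C). B \<union> C) ` ({A. f A \<noteq> 0} \<times> {A. g A \<noteq> 0})"
        using B by blast
    qed
    show "finite ((\<lambda>(B, C). B \<union> C) ` ({A. f A \<noteq> 0} \<times> {A. g A \<noteq> 0}))"
      using f g by simp
  qed
  show "finite A" if nz: "(\<Sum>B\<in>Pow A. f B * g (A - B)) \<noteq> 0" for A
  proof (rule ccontr)
    assume "infinite A"
    then have "infinite (Pow A)" by simp
    then show False using nz by simp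
  qed
qed

instance
proof
  fix a b c :: "'a grassmann"
  show "a + b + c = a + (b + c)" "a + b = b + a" "0 + a = a" "- a + a = 0"
    by (transfer; auto simp: algebra_simps)+
  show "a - b = a + - b" by (simp add: minus_grassmann_def)
  show "(0 :: 'a grassmann) \<noteq> 1" by transfer (metis zero_neq_one)
  show "(a + b) * c = a * c + b * c"
    by transfer (simp add: sum.distrib algebra_simps)
  show "a * b = b * a"
  proof (transfer, rule ext)
    fix f g :: "nat set \<Rightarrow> 'a" and A
    show "(\<Sum>B\<in>Pow A. f B * g (A - B)) = (\<Sum>B\<in>Pow A. g B * f (A - B))"
      by (rule sum.reindex_bij_witness[of _ "\<lambda>B. A - B" "\<lambda>B. A - B"])
         (auto simp: double_diff mult.commute)
  qed
  show "1 * a = a"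
  proof (rule grassmann_eqI)
    fix A :: "nat set" assume A: "finite A"
    have "coeff_of (1 * a) A = (\<Sum>B\<in>Pow A. (if B = {} then 1 else 0) * coeff_of a (A - B))"
      by transfer simp
    also have "\<dots> = (\<Sum>B\<in>Pow A. if B = {} then coeff_of a A else 0)"
      by (rule sum.cong) auto
    also have "\<dots> = coeff_of a A" using A by (simp add: sum.delta)
    finally show "coeff_of (1 * a) A = coeff_of a A" .
  qed
  show "a * b * c = a * (b * c)"
  proof (rule grassmann_eqI)
    fix A :: "nat set" assume A: "finite A"
    define f g h where "f = coeff_of a" and "g = coeff_of b" and "h = coeff_of c"
    have "coeff_of (a * b * c) A = (\<Sum>B\<in>Pow A. (\<Sum>C\<in>Pow B. f C * g (B - C)) * h (A - B))"
      unfolding f_def g_def h_def by transfer simp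
    also have "\<dots> = (\<Sum>B\<in>Pow A. \<Sum>C\<in>Pow B. f C * g (B - C) * h (A - B))"
      by (simp add: sum_distrib_right)
    also have "\<dots> = (\<Sum>(B, C)\<in>Sigma (Pow A) Pow. f C * g (B - C) * h (A - B))"
      by (rule sum.Sigma) (use A in \<open>auto intro: finite_subset\<close>)
    also have "\<dots> = (\<Sum>(C, D)\<in>Sigma (Pow A) (\<lambda>C. Pow (A - C)). f C * (g D * h (A - C - D)))"
    proof (rule sum.reindex_bij_witness[of _ "\<lambda>(C, D). (C \<union> D, C)" "\<lambda>(B, C). (C, B - C)"])
      fix p assume "p \<in> Sigma (Pow A) Pow"
      then obtain B C where p: "p = (B, C)" "B \<subseteq> A" "C \<subseteq> B" by auto
      then show "(\<lambda>(C, D). (C \<union> D, C)) ((\<lambda>(B, C). (C, B - C)) p) = p"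
        "(\<lambda>(B, C). (C, B - C)) p \<in> (SIGMA C:Pow A. Pow (A - C))" by auto
      have "A - C - (B - C) = A - B" using p by blast
      then show "(case (\<lambda>(B, C). (C, B - C)) p of (C, D) \<Rightarrow> f C * (g D * h (A - C - D)))
        = (case p of (B, C) \<Rightarrow> f C * g (B - C) * h (A - B))"
        by (simp add: p mult.assoc)
    next
      fix q assume "q \<in> (SIGMA C:Pow A. Pow (A - C))"
      then obtain C D where q: "q = (C, D)" "C \<subseteq> A" "D \<subseteq> A - C" by auto
      then show "(\<lambda>(B, C). (C, B - C)) ((\<lambda>(C, D). (C \<union> D, C)) q) = q"
        "(\<lambda>(C, D). (C \<union> D, C)) q \<in> Sigma (Pow A) Pow" by auto
    qed
    also have "\<dots> = (\<Sum>C\<in>Pow A. \<Sum>D\<in>Pow (A - C). f C * (g D * h (A - C - D)))"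
      by (rule sum.Sigma[symmetric]) (use A in auto)
    also have "\<dots> = (\<Sum>C\<in>Pow A. f C * (\<Sum>D\<in>Pow (A - C). g D * h (A - C - D)))"
      by (simp add: sum_distrib_left)
    also have "\<dots> = coeff_of (a * (b * c)) A"
      unfolding f_def g_def h_def by transfer simp
    finally show "coeff_of (a * b * c) A = coeff_of (a * (b * c)) A" .
  qed
qed

end

lift_definition gscale :: "'k::field \<Rightarrow> 'k grassmann \<Rightarrow> 'k grassmann" is "\<lambda>c f A. c * f A"
proof (intro conjI allI impI)
  fix c and f :: "nat set \<Rightarrow> 'k"
  assume f: "finite {A. f A \<noteq> 0} \<and> (\<forall>A. f A \<noteq> 0 \<longrightarrow> finite A)"
  show "finite {A. c * f A \<noteq> 0}"
    by (rule finite_subset[of _ "{A. f A \<noteq> 0}"]) (use f in auto)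
  show "finite A" if "c * f A \<noteq> 0" for A
    using that f by auto
qed

lift_definition gen :: "nat \<Rightarrow> 'k::field grassmann" is "\<lambda>i A. if A = {i} then 1 else 0"
  by simp

text \<open>
  In characteristic 2 this is the unique derivation with \<open>\<partial>\<^sub>i(x\<^sub>j) = \<delta>\<^sub>i\<^sub>j\<close>: see
  \<open>partial_gen\<close>, \<open>partial_derivation\<close> and \<open>grassmann_derivation_unique\<close> below.
\<close>

lift_definition partial :: "nat \<Rightarrow> 'k::field grassmann \<Rightarrow> 'k grassmann"
  is "\<lambda>i f A. if i \<in> A then 0 else f (insert i A)"
proof (intro conjI allI impI)
  fix i and f :: "nat set \<Rightarrow> 'k"
  assume f: "finite {A. f A \<noteq> 0} \<and> (\<forall>A. f A \<noteq> 0 \<longrightarrow> finite A)"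
  have "{A. (if i \<in> A then 0 else f (insert i A)) \<noteq> 0} \<subseteq> (\<lambda>A. A - {i}) ` {A. f A \<noteq> 0}"
  proof
    fix A assume "A \<in> {A. (if i \<in> A then 0 else f (insert i A)) \<noteq> 0}"
    then have "A = insert i A - {i}" "insert i A \<in> {A. f A \<noteq> 0}" by (auto split: if_splits)
    then show "A \<in> (\<lambda>A. A - {i}) ` {A. f A \<noteq> 0}" by blast
  qed
  then show "finite {A. (if i \<in> A then 0 else f (insert i A)) \<noteq> 0}"
    using f by (meson finite_imageI finite_subset)
  show "finite A" if "(if i \<in> A then 0 else f (insert i A)) \<noteq> 0" for A
    using that f by (auto split: if_splits)
qed

lemma coeff_plus: "coeff_of (f + g) A = coeff_of f A + coeff_of g A"
  and coeff_zero: "coeff_of 0 A = 0"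
  and coeff_one: "coeff_of 1 A = (if A = {} then 1 else 0)"
  and coeff_times: "coeff_of (f * g) A = (\<Sum>B\<in>Pow A. coeff_of f B * coeff_of g (A - B))"
  and coeff_gscale: "coeff_of (gscale c f) A = c * coeff_of f A"
  and coeff_gen: "coeff_of (gen i) A = (if A = {i} then 1 else 0)"
  and coeff_partial: "coeff_of (partial i f) A = (if i \<in> A then 0 else coeff_of f (insert i A))"
  by (transfer; simp)+

global_interpretation Grassmann: vector_space "gscale :: 'k::field \<Rightarrow> _"
  by unfold_locales (rule grassmann_eqI; simp add: coeff_plus coeff_gscale algebra_simps)+

lemma coeff_gen_times:
  assumes "finite A"
  shows "coeff_of (gen i * f) A = (if i \<in> A then coeff_of f (A - {i}) else 0)"
proof -
  have "coeff_of (gen i * f) A = (\<Sum>B\<in>Pow A. if B = {i} then coeff_of f (A - {i}) else 0)"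
    unfolding coeff_times coeff_gen by (rule sum.cong) auto
  then show ?thesis using assms by (simp add: sum.delta)
qed

lemma gscale_mult_left: "gscale c f * g = gscale c (f * g)"
  by (rule grassmann_eqI) (simp add: coeff_times coeff_gscale sum_distrib_left mult.assoc)

lemma gscale_mult_right: "f * gscale c g = gscale c (f * g)"
  by (metis gscale_mult_left mult.commute)

lemma gen_square: "gen i * gen i = 0"
  by (rule grassmann_eqI) (auto simp: coeff_gen_times coeff_gen coeff_zero)

lemma coeff_prod_gen:
  assumes "finite A"
  shows "coeff_of (\<Prod>i\<in>A. gen i :: 'k::field grassmann) B = (if B = A then 1 else 0)"
proof (cases "finite B")
  case True
  with assms show ?thesis
  proof (induction A arbitrary: B)
    case empty
    then show ?case by (simp add: coeff_one)
  next
    case (insert a A)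
    then show ?case by (auto simp: coeff_gen_times)
  qed
next
  case False
  then show ?thesis using assms coeff_of[of "\<Prod>i\<in>A. gen i :: 'k grassmann"] by auto
qed

lemma grassmann_expand:
  "f = (\<Sum>A | coeff_of f A \<noteq> 0. gscale (coeff_of f A) (\<Prod>i\<in>A. gen i))"
proof (rule grassmann_eqI)
  fix B :: "nat set"
  have fin: "finite {A. coeff_of f A \<noteq> 0}" "\<And>A. coeff_of f A \<noteq> 0 \<Longrightarrow> finite A"
    using coeff_of[of f] by auto
  have sm: "coeff_of (sum F S) B = (\<Sum>A\<in>S. coeff_of (F A) B)" if "finite S"
    for F :: "nat set \<Rightarrow> 'a grassmann" and S
    using that by induction (auto simp: coeff_zero coeff_plus)
  have "coeff_of (\<Sum>A | coeff_of f A \<noteq> 0. gscale (coeff_of f A) (\<Prod>i\<in>A. gen i)) B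
    = (\<Sum>A | coeff_of f A \<noteq> 0. if A = B then coeff_of f B else 0)"
    unfolding sm[OF fin(1)]
    by (rule sum.cong) (auto simp: coeff_gscale coeff_prod_gen fin)
  also have "\<dots> = coeff_of f B" using fin by (simp add: sum.delta)
  finally show "coeff_of f B
    = coeff_of (\<Sum>A | coeff_of f A \<noteq> 0. gscale (coeff_of f A) (\<Prod>i\<in>A. gen i)) B" by simp
qed

definition grassmann_derivation :: "('k::field grassmann \<Rightarrow> 'k grassmann) \<Rightarrow> bool" where
  "grassmann_derivation D \<longleftrightarrow>
    Vector_Spaces.linear gscale gscale D \<and> (\<forall>f g. D (f * g) = D f * g + f * D g)"

lemma linear_grassmannI:
  assumes "\<And>f g. T (f + g) = T f + T g" "\<And>c f. T (gscale c f) = gscale c (T f)"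
  shows "Vector_Spaces.linear gscale gscale T"
  by unfold_locales (use assms in auto)

lemma linear_partial: "Vector_Spaces.linear gscale gscale (partial i)"
  by (rule linear_grassmannI; rule grassmann_eqI; simp add: coeff_partial coeff_plus coeff_gscale)

lemma partial_gen: "partial i (gen j :: 'k::field grassmann) = (if i = j then 1 else 0)"
  by (rule grassmann_eqI) (auto simp: coeff_partial coeff_gen coeff_one coeff_zero)

lemma char_two_double:
  assumes "CHAR('k::field) = 2"
  shows "(c :: 'k) + c = 0"
proof -
  have "of_nat 2 = (0 :: 'k)" using of_nat_CHAR[where 'a = 'k] assms by simp
  then have "(2 :: 'k) = 0" by simp
  then show ?thesis by (metis mult_2 mult_zero_left)
qed

lemma partial_derivation:
  assumes "CHAR('k::field) = 2"
  shows "grassmann_derivation (partial i :: 'k grassmann \<Rightarrow> 'k grassmann)"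
  unfolding grassmann_derivation_def
proof (intro conjI allI linear_partial grassmann_eqI)
  fix f g :: "'k grassmann" and A :: "nat set"
  assume A: "finite A"
  define F G where "F = coeff_of f" and "G = coeff_of g"
  have split: "(\<Sum>B\<in>Pow (insert i C). H B)
      = (\<Sum>B\<in>Pow C. H B) + (\<Sum>B\<in>Pow C. H (insert i B))"
    if "finite C" "i \<notin> C" for C and H :: "nat set \<Rightarrow> 'k"
  proof -
    have "inj_on (insert i) (Pow C)" using that by (auto simp: inj_on_def)
    moreover have "Pow C \<inter> insert i ` Pow C = {}" using that by auto
    ultimately show ?thesis
      using that by (simp add: Pow_insert sum.union_disjoint sum.reindex)
  qed
  show "coeff_of (partial i (f * g)) A = coeff_of (partial i f * g + f * partial i g) A"
  proof (cases "i \<in> A")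
    case False
    have "coeff_of (partial i (f * g)) A
      = (\<Sum>B\<in>Pow A. F B * G (insert i A - B)) + (\<Sum>B\<in>Pow A. F (insert i B) * G (insert i A - insert i B))"
      using False A by (simp add: coeff_partial coeff_times F_def G_def split)
    moreover have "(\<Sum>B\<in>Pow A. F B * G (insert i A - B))
      = (\<Sum>B\<in>Pow A. F B * coeff_of (partial i g) (A - B))"
      by (rule sum.cong)
         (use False in \<open>auto simp: coeff_partial G_def insert_Diff_if\<close>)
    moreover have "(\<Sum>B\<in>Pow A. F (insert i B) * G (insert i A - insert i B))
      = (\<Sum>B\<in>Pow A. coeff_of (partial i f) B * G (A - B))"
    proof (rule sum.cong)
      fix B assume "B \<in> Pow A"
      then have "i \<notin> B" "insert i A - insert i B = A - B" using False by auto
      then show "F (insert i B) * G (insert i A - insert i B)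
        = coeff_of (partial i f) B * G (A - B)"
        by (simp add: coeff_partial F_def)
    qed simp
    ultimately show ?thesis
      by (simp add: coeff_plus coeff_times F_def G_def add.commute)
  next
    case True
    define C where "C = A - {i}"
    have C: "finite C" "i \<notin> C" "A = insert i C" using True A by (auto simp: C_def)
    have e1: "coeff_of (partial i f * g) A = (\<Sum>B\<in>Pow C. F (insert i B) * G (insert i (C - B)))"
    proof -
      have "coeff_of (partial i f * g) A
        = (\<Sum>B\<in>Pow C. coeff_of (partial i f) B * G (insert i C - B))"
        unfolding C(3) coeff_times split[OF C(1,2)] by (simp add: coeff_partial G_def)
      also have "\<dots> = (\<Sum>B\<in>Pow C. F (insert i B) * G (insert i (C - B)))"
        by (rule sum.cong) (use C in \<open>auto simp: coeff_partial F_def insert_Diff_if\<close>)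
      finally show ?thesis .
    qed
    have e2: "coeff_of (f * partial i g) A = (\<Sum>B\<in>Pow C. F (insert i B) * G (insert i (C - B)))"
    proof -
      have "(\<Sum>B\<in>Pow C. F B * coeff_of (partial i g) (insert i C - B)) = 0"
        by (rule sum.neutral) (use C in \<open>auto simp: coeff_partial\<close>)
      then have "coeff_of (f * partial i g) A
        = (\<Sum>B\<in>Pow C. F (insert i B) * coeff_of (partial i g) (insert i C - insert i B))"
        unfolding C(3) coeff_times split[OF C(1,2)] by (simp add: F_def)
      also have "\<dots> = (\<Sum>B\<in>Pow C. F (insert i B) * G (insert i (C - B)))"
      proof (rule sum.cong)
        fix B assume "B \<in> Pow C"
        then have "insert i C - insert i B = C - B" using C by auto
        then show "F (insert i B) * coeff_of (partial i g) (insert i C - insert i B)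
          = F (insert i B) * G (insert i (C - B))"
          using C by (simp add: coeff_partial G_def)
      qed simp
      finally show ?thesis .
    qed
    show ?thesis
      using True by (simp add: coeff_plus e1 e2 char_two_double[OF assms] coeff_partial)
  qed
qed

lemma grassmann_derivation_unique:
  assumes D: "grassmann_derivation D" and E: "grassmann_derivation E"
    and eq: "\<And>j. D (gen j) = E (gen j)"
  shows "D = (E :: 'k::field grassmann \<Rightarrow> _)"
proof
  fix f :: "'k grassmann"
  interpret D: Vector_Spaces.linear "gscale :: 'k \<Rightarrow> _" gscale D
    using D by (simp add: grassmann_derivation_def)
  interpret E: Vector_Spaces.linear "gscale :: 'k \<Rightarrow> _" gscale E
    using E by (simp add: grassmann_derivation_def)
  have one: "T 1 = 0" if "grassmann_derivation T" for T :: "'k grassmann \<Rightarrow> _"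
  proof -
    have "T (1 * 1) = T 1 * 1 + 1 * T 1" using that unfolding grassmann_derivation_def by blast
    then show ?thesis by simp
  qed
  have mon: "D (\<Prod>i\<in>A. gen i) = E (\<Prod>i\<in>A. gen i)" if "finite A" for A
    using that
  proof induction
    case empty
    show ?case using one[OF D] one[OF E] by simp
  next
    case (insert a A)
    then show ?case using D E eq by (simp add: grassmann_derivation_def)
  qed
  have "finite A" if "coeff_of f A \<noteq> 0" for A using coeff_of[of f] that by auto
  then show "D f = E f"
    by (subst (1 2) grassmann_expand[of f]) (auto simp: D.sum E.sum D.scale E.scale mon intro!: sum.cong)
qed

section \<open>The endomorphism Lie algebra\<close>

type_synonym 'k endo = "'k grassmann \<Rightarrow> 'k grassmann"

text \<open>
  Linear endomorphisms are singled out as a subset of the space of all functions, which is a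
  vector space under the pointwise operations.
\<close>

definition escale :: "'k::field \<Rightarrow> 'k endo \<Rightarrow> 'k endo" where
  "escale c T = (\<lambda>f. gscale c (T f))"

global_interpretation Endo: vector_space "escale :: 'k::field \<Rightarrow> _"
  by unfold_locales
    (auto simp: escale_def fun_eq_iff Grassmann.scale_right_distrib Grassmann.scale_left_distrib)

definition EndL :: "'k::field endo set" where
  "EndL = {T. Vector_Spaces.linear gscale gscale T}"

text \<open>In characteristic 2 this is the commutator \<open>ab - ba\<close>.\<close>

definition bracket :: "'k::field endo \<Rightarrow> 'k endo \<Rightarrow> 'k endo" where
  "bracket a b = (a \<circ> b) + (b \<circ> a)"

definition lie_subalgebra :: "'k::field endo set \<Rightarrow> bool" where
  "lie_subalgebra A \<longleftrightarrow>
    A \<subseteq> EndL \<and> Endo.subspace A \<and> (\<forall>a\<in>A. \<forall>b\<in>A. bracket a b \<in> A)"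

definition lie_generated :: "'k::field endo set \<Rightarrow> 'k endo set" where
  "lie_generated S = \<Inter>{A. lie_subalgebra A \<and> S \<subseteq> A}"

lemma EndL_add: "T \<in> EndL \<Longrightarrow> T (f + g) = T f + T g"
  and EndL_scale: "T \<in> EndL \<Longrightarrow> T (gscale c f) = gscale c (T f)"
  by (simp_all add: EndL_def Vector_Spaces.linear_iff)

lemma EndL_I:
  assumes "\<And>f g. T (f + g) = T f + T g" "\<And>c f. T (gscale c f) = gscale c (T f)"
  shows "T \<in> EndL"
  unfolding EndL_def mem_Collect_eq using assms by (rule linear_grassmannI)

lemma lie_subalgebra_EndL: "lie_subalgebra (EndL :: 'k::field endo set)"
  unfolding lie_subalgebra_def
proof (intro conjI ballI subset_refl)
  show "Endo.subspace (EndL :: 'k endo set)"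
  proof (rule Endo.subspaceI)
    show "0 \<in> (EndL :: 'k endo set)" by (rule EndL_I) simp_all
  next
    fix a b :: "'k endo" assume "a \<in> EndL" "b \<in> EndL"
    then show "a + b \<in> EndL"
      by (intro EndL_I) (simp_all add: EndL_add EndL_scale Grassmann.scale_right_distrib)
  next
    fix c :: 'k and a :: "'k endo" assume "a \<in> EndL"
    then show "escale c a \<in> EndL"
      by (intro EndL_I)
        (simp_all add: escale_def EndL_add EndL_scale Grassmann.scale_right_distrib
          Grassmann.scale_left_commute)
  qed
  show "bracket a b \<in> EndL" if "a \<in> EndL" "b \<in> EndL" for a b :: "'k endo"
    using that
    by (intro EndL_I)
       (simp_all add: bracket_def EndL_add EndL_scale Grassmann.scale_right_distrib add_ac)
qed

lemma lie_subalgebra_lie_generated: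
  assumes "S \<subseteq> EndL"
  shows "lie_subalgebra (lie_generated S)"
  unfolding lie_subalgebra_def
proof (intro conjI ballI)
  show "lie_generated S \<subseteq> EndL"
    using assms lie_subalgebra_EndL by (auto simp: lie_generated_def)
  show "Endo.subspace (lie_generated S)"
    unfolding lie_generated_def
    by (rule Endo.subspace_Inter) (simp add: lie_subalgebra_def)
  show "bracket a b \<in> lie_generated S" if "a \<in> lie_generated S" "b \<in> lie_generated S" for a b
    using that by (simp add: lie_generated_def lie_subalgebra_def)
qed

lemma grassmann_double:
  assumes "CHAR('k::field) = 2"
  shows "(f :: 'k grassmann) + f = 0"
  by (rule grassmann_eqI) (simp only: coeff_plus coeff_zero char_two_double[OF assms])

lemma bracket_self: "CHAR('k::field) = 2 \<Longrightarrow> bracket a a = (0 :: 'k endo)"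
  by (rule ext) (simp only: bracket_def plus_fun_apply zero_fun_apply grassmann_double)

lemma bracket_jacobi:
  assumes "CHAR('k::field) = 2" "a \<in> EndL" "b \<in> EndL" "c \<in> EndL"
  shows "bracket a (bracket b c) + bracket b (bracket c a) + bracket c (bracket a b)
    = (0 :: 'k endo)"
proof
  fix f :: "'k grassmann"
  have d: "x + (x + y) = y" for x y :: "'k grassmann"
    by (simp add: grassmann_double[OF assms(1)] flip: add.assoc)
  show "(bracket a (bracket b c) + bracket b (bracket c a) + bracket c (bracket a b)) f = 0 f"
    using assms(2-) by (simp add: bracket_def EndL_add ac_simps d grassmann_double[OF assms(1)])
qed

text \<open>The internal direct sum is over \<open>n \<ge> 1\<close>; the value \<open>L 0\<close> plays no role.\<close>

definition graded_lie_algebra :: "'k::field endo set \<Rightarrow> (nat \<Rightarrow> 'k endo set) \<Rightarrow> bool" where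
  "graded_lie_algebra A L \<longleftrightarrow>
    lie_subalgebra A \<and>
    (\<forall>n\<ge>1. Endo.subspace (L n) \<and> L n \<subseteq> A) \<and>
    (\<forall>a\<in>A. \<exists>!r. r 0 = 0 \<and> (\<forall>n\<ge>1. r n \<in> L n) \<and> finite {n. r n \<noteq> 0} \<and> a = Sum_any r) \<and>
    (\<forall>m\<ge>1. \<forall>n\<ge>1. \<forall>a\<in>L m. \<forall>b\<in>L n. bracket a b \<in> L (m + n))"

text \<open>
  The dimension of an infinite-dimensional space is \<open>0\<close> in the library, hence the separate
  requirement of finite dimension.
\<close>

definition dim_at_most :: "'k::field endo set \<Rightarrow> nat \<Rightarrow> bool" where
  "dim_at_most V d \<longleftrightarrow> (\<exists>B. finite B \<and> V \<subseteq> Endo.span B) \<and> Endo.dim V \<le> d"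

definition has_width :: "(nat \<Rightarrow> 'k::field endo set) \<Rightarrow> nat \<Rightarrow> bool" where
  "has_width L d \<longleftrightarrow>
    (\<forall>n\<ge>1. dim_at_most (L n) d) \<and> (\<forall>d'. (\<forall>n\<ge>1. dim_at_most (L n) d') \<longrightarrow> d \<le> d')"

definition thin :: "(nat \<Rightarrow> 'k::field endo set) \<Rightarrow> bool" where
  "thin L \<longleftrightarrow> Endo.dim (L 1) = 2 \<and>
    (\<forall>n\<ge>1. \<forall>z\<in>L n. z \<noteq> 0 \<longrightarrow> L (n + 1) = (\<lambda>a. bracket a z) ` L 1)"

section \<open>Pivot elements and the Lie algebra generated by the first two\<close>

text \<open>
  The nested expression for the pivot element \<open>v\<^sub>i\<close>, multiplied out:
  \<open>v\<^sub>i = \<Sum>k. (x\<^sub>i x\<^bsub>i+1\<^esub> \<dots> x\<^bsub>i+2k-1\<^esub>) \<partial>\<^bsub>i+2k\<^esub>\<close>. Only finitely many summands act nontrivially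
  on a given element; the lemma \<open>pivot_rec\<close> below recovers the recursion.
\<close>

definition pivot :: "nat \<Rightarrow> 'k::field endo" where
  "pivot i f = Sum_any (\<lambda>k. (\<Prod>j<2 * k. gen (i + j)) * partial (i + 2 * k) f)"

lemma finite_partial_nonzero: "finite {j. partial j (f :: 'k::field grassmann) \<noteq> 0}"
proof (rule finite_subset)
  show "{j. partial j f \<noteq> 0} \<subseteq> \<Union>{A. coeff_of f A \<noteq> 0}"
  proof
    fix j assume "j \<in> {j. partial j f \<noteq> 0}"
    then obtain A where "coeff_of (partial j f) A \<noteq> 0"
      using grassmann_eqI[of "partial j f" 0] by (auto simp: coeff_zero)
    then have "coeff_of f (insert j A) \<noteq> 0" by (auto simp: coeff_partial split: if_splits)
    then show "j \<in> \<Union>{A. coeff_of f A \<noteq> 0}" by blast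
  qed
  show "finite (\<Union>{A. coeff_of f A \<noteq> 0})" using coeff_of[of f] by auto
qed

lemma finite_pivot_summands:
  "finite {k. (\<Prod>j<2 * k. gen (i + j)) * partial (i + 2 * k) (f :: 'k::field grassmann) \<noteq> 0}"
proof (rule finite_subset)
  show "{k. (\<Prod>j<2 * k. gen (i + j)) * partial (i + 2 * k) f \<noteq> 0}
    \<subseteq> (\<lambda>k. i + 2 * k) -` {j. partial j f \<noteq> 0}" by auto
  show "finite ((\<lambda>k. i + 2 * k) -` {j. partial j f \<noteq> 0})"
    by (rule finite_vimageI[OF finite_partial_nonzero]) (simp add: inj_def)
qed

lemma pivot_rec: "pivot i f = partial i f + gen i * gen (i + 1) * pivot (i + 2) (f :: 'k::field grassmann)"
proof -
  define t where "t i k = (\<Prod>j<2 * k. gen (i + j)) * partial (i + 2 * k) f" for i k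
  have fin: "finite {k. t i k \<noteq> 0}" for i
    unfolding t_def by (rule finite_pivot_summands)
  then obtain N where N: "{k. t i k \<noteq> 0} \<union> {k. t (i + 2) k \<noteq> 0} \<subseteq> {..<N}"
    by (meson finite_UnI finite_nat_iff_bounded)
  have step: "t i (Suc k) = gen i * gen (i + 1) * t (i + 2) k" for k
    unfolding t_def by (simp add: prod.lessThan_Suc_shift mult.assoc del: prod.lessThan_Suc)
  have "pivot i f = sum (t i) {..<Suc N}"
    unfolding pivot_def t_def[symmetric] by (rule Sum_any.expand_superset) (use N in auto)
  also have "\<dots> = t i 0 + (\<Sum>k<N. t i (Suc k))" by (rule sum.lessThan_Suc_shift)
  also have "(\<Sum>k<N. t i (Suc k)) = gen i * gen (i + 1) * (\<Sum>k<N. t (i + 2) k)"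
    by (simp add: step sum_distrib_left)
  also have "(\<Sum>k<N. t (i + 2) k) = pivot (i + 2) f"
    unfolding pivot_def t_def[symmetric]
    by (rule Sum_any.expand_superset[symmetric]) (use N in auto)
  finally show ?thesis by (simp add: t_def)
qed

lemma pivot_in_EndL: "pivot i \<in> (EndL :: 'k::field endo set)"
proof -
  have p: "partial j \<in> (EndL :: 'k endo set)" for j
    by (simp add: EndL_def linear_partial)
  show ?thesis
  proof (rule EndL_I)
    fix f g :: "'k grassmann"
    show "pivot i (f + g) = pivot i f + pivot i g"
      unfolding pivot_def
      by (simp add: EndL_add[OF p] ring_distribs Sum_any.distrib finite_pivot_summands)
  next
    fix c :: 'k and f :: "'k grassmann"
    define t where "t k = (\<Prod>j<2 * k. gen (i + j)) * partial (i + 2 * k) f" for k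
    have fin: "finite {k. t k \<noteq> 0}" unfolding t_def by (rule finite_pivot_summands)
    have "pivot i (gscale c f) = Sum_any (\<lambda>k. gscale c (t k))"
      unfolding pivot_def t_def by (simp add: EndL_scale[OF p] gscale_mult_right)
    also have "\<dots> = (\<Sum>k | t k \<noteq> 0. gscale c (t k))"
      by (rule Sum_any.expand_superset[OF fin]) auto
    also have "\<dots> = gscale c (pivot i f)"
      unfolding pivot_def t_def[symmetric] Sum_any.expand_set Grassmann.scale_sum_right ..
    finally show "pivot i (gscale c f) = gscale c (pivot i f)" .
  qed
qed

definition LieR :: "'k::field endo set" where
  "LieR = lie_generated {pivot 0, pivot 1}"

text \<open>Commutators of length \<open>n\<close> in the two generators, with arbitrary bracketing.\<close>

inductive commutator :: "nat \<Rightarrow> 'k::field endo \<Rightarrow> bool" where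
  "commutator 1 (pivot 0)"
| "commutator 1 (pivot 1)"
| "commutator m a \<Longrightarrow> commutator n b \<Longrightarrow> commutator (m + n) (bracket a b)"

definition LieR_comp :: "nat \<Rightarrow> 'k::field endo set" where
  "LieR_comp n = Endo.span {a. commutator n a}"

end

theory Submission
  imports Defs
begin

text \<open>
  With weights \<open>1, 1, 3, 5, 11, \<dots>\<close> for \<open>v\<^sub>0, v\<^sub>1, v\<^sub>2, \<dots>\<close> and opposite weights for the letters,
  \<open>[v\<^sub>i, v\<^sub>n]\<close> is \<open>x\<^sub>i \<cdots> x\<^bsub>n-1\<^esub> v\<^bsub>n+1\<^esub>\<close> or \<open>0\<close> according to the parity of \<open>n - i > 0\<close>. Hence the span
  of the monomials \<open>x\<^sub>A v\<^sub>n\<close> with \<open>A \<subseteq> {0, \<dots>, n - 2}\<close> is stable under \<open>v\<^sub>0\<close> and \<open>v\<^sub>1\<close>, and it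
  contains \<open>\<bold>R\<close>. Since \<open>a\<^sub>0 + \<cdots> + a\<^bsub>n-1\<^esub> \<le> a\<^sub>n\<close> for the weights \<open>a\<^sub>n\<close>, at most two of these monomials have
  a given weight. The covering property fails at \<open>z = v\<^sub>2\<close>: the element \<open>x\<^sub>0 v\<^sub>3\<close> of degree 4 is not
  in \<open>[\<bold>R\<^sub>1, v\<^sub>2]\<close>, which is spanned by \<open>x\<^sub>1 v\<^sub>3\<close>.
\<close>

section \<open>Monomials and pivot elements\<close>

definition mon :: "nat set \<Rightarrow> 'k::field grassmann" where
  "mon A = (\<Prod>i\<in>A. gen i)"

lemma coeff_mon: "finite A \<Longrightarrow> coeff_of (mon A) B = (if B = A then 1 else 0)"
  by (simp add: mon_def coeff_prod_gen)

lemma mon_empty [simp]: "mon {} = 1"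
  by (simp add: mon_def)

lemma mon_singleton: "mon {i} = gen i"
  by (simp add: mon_def)

lemma mon_mult:
  assumes "finite A" "finite B"
  shows "mon A * mon B = (if A \<inter> B = {} then mon (A \<union> B) else 0)"
proof (cases "A \<inter> B = {}")
  case True
  then show ?thesis using assms by (simp add: mon_def prod.union_disjoint)
next
  case False
  then obtain i where i: "i \<in> A" "i \<in> B" by blast
  have "mon A * mon B = gen i * gen i * (mon (A - {i}) * mon (B - {i}))"
    unfolding mon_def prod.remove[OF assms(1) i(1)] prod.remove[OF assms(2) i(2)]
    by (simp only: mult_ac)
  then show ?thesis using False by (simp add: gen_square)
qed

lemma partial_mon:
  assumes "finite A"
  shows "partial i (mon A) = (if i \<in> A then mon (A - {i}) else 0)"
  by (rule grassmann_eqI) (use assms in \<open>auto simp: coeff_partial coeff_mon coeff_zero\<close>)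

lemma prod_gen_shift: "(\<Prod>j<k. gen (i + j)) = mon {i..<i + k}"
  unfolding mon_def
  by (rule prod.reindex_bij_witness[of _ "\<lambda>j. j - i" "\<lambda>j. i + j"]) auto

section \<open>Pivot elements as derivations of the Grassmann algebra\<close>

lemma pivot_eq: "pivot i f = Sum_any (\<lambda>k. mon {i..<i + 2 * k} * partial (i + 2 * k) f)"
  by (simp add: pivot_def prod_gen_shift)

lemma finite_pivot_support:
  "finite {k. mon {i..<i + 2 * k} * partial (i + 2 * k) (f :: 'k::field grassmann) \<noteq> 0}"
  using finite_pivot_summands[of i f] by (simp add: prod_gen_shift)

text \<open>A bound \<open>N\<close> exists for each fixed \<open>f\<close>, since only finitely
  many letters occur in it. The finite form allows closure of subspaces and graded pieces under sums
  to be applied.\<close>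

lemma pivot_as_sum:
  obtains N where "pivot i (f :: 'k::field grassmann)
    = (\<Sum>k<N. mon {i..<i + 2 * k} * partial (i + 2 * k) f)"
proof -
  obtain N where "{k. mon {i..<i + 2 * k} * partial (i + 2 * k) f \<noteq> 0} \<subseteq> {..<N}"
    using finite_pivot_support[of i f] by (meson finite_nat_iff_bounded)
  then have "pivot i f = (\<Sum>k<N. mon {i..<i + 2 * k} * partial (i + 2 * k) f)"
    unfolding pivot_eq by (intro Sum_any.expand_superset) auto
  then show thesis by (rule that)
qed

lemma derivation_one:
  assumes "grassmann_derivation D"
  shows "D 1 = 0"
proof -
  have "D (1 * 1) = D 1 * 1 + 1 * D 1"
    using assms unfolding grassmann_derivation_def by blast
  then show ?thesis by simp
qed

lemma derivation_mult: "grassmann_derivation D \<Longrightarrow> D (f * g) = D f * g + f * D g"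
  by (simp add: grassmann_derivation_def)

lemma derivation_EndL: "grassmann_derivation D \<Longrightarrow> D \<in> EndL"
  by (simp add: grassmann_derivation_def EndL_def)

lemma derivation_zero: "grassmann_derivation D \<Longrightarrow> D 0 = 0"
  using derivation_mult[of D 0 0] by simp

lemma derivation_add: "grassmann_derivation D \<Longrightarrow> D (f + g) = D f + D g"
  by (rule EndL_add[OF derivation_EndL])

text \<open>Each summand is a fixed element times a derivation. Finite support on every argument is
  what permits the infinite sum to be split.\<close>

lemma pivot_derivation:
  assumes "CHAR('k::field) = 2"
  shows "grassmann_derivation (pivot i :: 'k endo)"
  unfolding grassmann_derivation_def
proof (intro conjI allI)
  show "Vector_Spaces.linear gscale gscale (pivot i :: 'k endo)"
    using pivot_in_EndL by (simp add: EndL_def)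
  fix f g :: "'k grassmann"
  define t where "t f k = mon {i..<i + 2 * k} * partial (i + 2 * k) f" for k and f :: "'k grassmann"
  have fin: "finite {k. t f k \<noteq> 0}" for f unfolding t_def by (rule finite_pivot_support)
  have fl: "finite {k. t f k * g \<noteq> 0}"
    by (rule finite_subset[OF _ fin[of f]]) auto
  have fr: "finite {k. f * t g k \<noteq> 0}"
    by (rule finite_subset[OF _ fin[of g]]) auto
  have "t (f * g) = (\<lambda>k. t f k * g + f * t g k)"
    unfolding t_def fun_eq_iff derivation_mult[OF partial_derivation[OF assms]]
    by (simp only: distrib_left mult_ac simp_thms)
  then have "pivot i (f * g) = Sum_any (\<lambda>k. t f k * g + f * t g k)"
    unfolding pivot_eq t_def[symmetric] by (rule arg_cong)
  also have "\<dots> = Sum_any (t f) * g + f * Sum_any (t g)"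
    by (simp add: Sum_any.distrib[OF fl fr] Sum_any_left_distrib[OF fin] Sum_any_right_distrib[OF fin])
  finally show "pivot i (f * g) = pivot i f * g + f * pivot i g"
    unfolding pivot_eq t_def[symmetric] .
qed

lemma pivot_gen:
  "pivot i (gen j :: 'k::field grassmann) = (if i \<le> j \<and> even (j - i) then mon {i..<j} else 0)"
proof (cases "i \<le> j \<and> even (j - i)")
  case True
  then obtain l where l: "j = i + 2 * l" by (metis evenE le_add_diff_inverse)
  have "(\<lambda>k. mon {i..<i + 2 * k} * partial (i + 2 * k) (gen j :: 'k grassmann))
    = (\<lambda>k. if k = l then mon {i..<j} else 0)"
    by (auto simp: partial_gen l)
  then show ?thesis using True by (simp only: pivot_eq Sum_any.delta if_True simp_thms)
next
  case False
  then have "i + 2 * k \<noteq> j" for k by auto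
  then have "(\<lambda>k. mon {i..<i + 2 * k} * partial (i + 2 * k) (gen j :: 'k grassmann)) = (\<lambda>k. 0)"
    unfolding partial_gen by simp
  then have "pivot i (gen j :: 'k grassmann) = Sum_any (\<lambda>k :: nat. 0)"
    by (simp only: pivot_eq)
  then show ?thesis using False by auto
qed

section \<open>Brackets of pivot elements\<close>

lemma bracket_apply: "bracket a b f = a (b f) + b (a f)"
  by (simp add: bracket_def)

lemma bracket_commute: "bracket a b = bracket b a"
  by (simp add: bracket_def add.commute)

lemma bracket_in_EndL: "a \<in> EndL \<Longrightarrow> b \<in> EndL \<Longrightarrow> bracket a b \<in> EndL"
  using lie_subalgebra_EndL unfolding lie_subalgebra_def by blast

text \<open>The cross terms \<open>D f * E g\<close> and \<open>E f * D g\<close> each occur twice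
  in \<open>ab + ba\<close> and vanish in characteristic 2.\<close>

lemma bracket_derivation:
  assumes "CHAR('k::field) = 2" and D: "grassmann_derivation D" and E: "grassmann_derivation E"
  shows "grassmann_derivation (bracket D E :: 'k endo)"
  unfolding grassmann_derivation_def
proof (intro conjI allI)
  show "Vector_Spaces.linear gscale gscale (bracket D E)"
    using bracket_in_EndL[OF derivation_EndL[OF D] derivation_EndL[OF E]] by (simp add: EndL_def)
  fix f g :: "'k grassmann"
  have "bracket D E (f * g) = bracket D E f * g + f * bracket D E g
      + (D f * E g + D f * E g) + (E f * D g + E f * D g)"
    by (simp add: bracket_apply derivation_mult[OF D] derivation_mult[OF E]
        derivation_add[OF D] derivation_add[OF E] algebra_simps)
  then show "bracket D E (f * g) = bracket D E f * g + f * bracket D E g"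
    by (simp only: grassmann_double[OF assms(1)] add_0_right)
qed

text \<open>\<open>pivot n\<close> involves only letters and partial derivatives of index at least
  \<open>n\<close>, so the bracket, a derivation, vanishes on all generators; uniqueness of
  derivations does the rest.\<close>

lemma partial_pivot_commute:
  assumes "CHAR('k::field) = 2" "i < n"
  shows "partial i (pivot n f) = pivot n (partial i (f :: 'k grassmann))"
proof -
  note D = partial_derivation[OF assms(1), of i] and P = pivot_derivation[OF assms(1), of n]
  have "bracket (partial i) (pivot n) = (0 :: 'k endo)"
  proof (rule grassmann_derivation_unique)
    show "grassmann_derivation (bracket (partial i) (pivot n) :: 'k endo)"
      by (rule bracket_derivation[OF assms(1) D P])
    show "grassmann_derivation (0 :: 'k endo)"
      unfolding grassmann_derivation_def by (auto intro: linear_grassmannI)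
    show "bracket (partial i) (pivot n) (gen j) = (0 :: 'k endo) (gen j)" for j
      using assms(2) by (simp add: bracket_apply pivot_gen partial_gen partial_mon
          derivation_zero[OF P] derivation_one[OF P] derivation_zero[OF partial_derivation[OF assms(1)]])
  qed
  then have "bracket (partial i) (pivot n) f = 0" by simp
  then have "partial i (pivot n f) + pivot n (partial i f) + pivot n (partial i f)
      = pivot n (partial i f)"
    by (simp add: bracket_apply)
  then show ?thesis by (simp only: add.assoc grassmann_double[OF assms(1)] add_0_right)
qed

text \<open>Every summand of v_i after the first contains x_i, and x_i^2 = 0.\<close>

lemma gen_times_pivot: "gen i * pivot i f = gen i * partial i f"
proof -
  have "gen i * pivot i f = gen i * partial i f + gen i * gen i * (gen (i + 1) * pivot (i + 2) f)"
    by (subst pivot_rec) (simp only: distrib_left mult_ac)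
  then show ?thesis by (simp add: gen_square)
qed

text \<open>Multiplication by x_i turns v_i into \<open>partial i\<close>, which commutes with
  v_(i+1). The factor x_i moves freely through v_(i+1), because v_(i+1) kills x_i.\<close>

lemma gen_times_bracket_pivot_Suc:
  assumes c: "CHAR('k::field) = 2"
  shows "gen i * bracket (pivot i) (pivot (Suc i)) f = (0 :: 'k grassmann)"
proof -
  note P = derivation_mult[OF pivot_derivation[OF c]]
  have "gen i * pivot (Suc i) (pivot i f) = pivot (Suc i) (gen i * pivot i f)"
    by (simp add: P pivot_gen)
  also have "\<dots> = gen i * pivot (Suc i) (partial i f)"
    by (simp add: gen_times_pivot P pivot_gen)
  also have "\<dots> = gen i * pivot i (pivot (Suc i) f)"
    by (simp add: gen_times_pivot partial_pivot_commute[OF c])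
  finally show ?thesis
    by (simp add: bracket_apply distrib_left grassmann_double[OF c])
qed

text \<open>Expand v_i by its recursion: the part \<open>partial i\<close> commutes with v_n, and
  the Leibniz rule handles the rest.\<close>

lemma bracket_pivot_rec:
  assumes c: "CHAR('k::field) = 2" and "i < n"
  shows "bracket (pivot i) (pivot n) (f :: 'k grassmann)
    = pivot n (gen i * gen (i + 1)) * pivot (i + 2) f
      + gen i * gen (i + 1) * bracket (pivot (i + 2)) (pivot n) f"
proof -
  note P = pivot_derivation[OF c, of n]
  have "bracket (pivot i) (pivot n) f
    = (pivot n (partial i f) + pivot n (partial i f))
      + (pivot n (gen i * gen (i + 1)) * pivot (i + 2) f
      + gen i * gen (i + 1) * bracket (pivot (i + 2)) (pivot n) f)"
    unfolding bracket_apply pivot_rec[of i] derivation_add[OF P] partial_pivot_commute[OF assms]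
      derivation_mult[OF P, of "gen i * gen (i + 1)"]
    by (simp only: distrib_left add_ac)
  then show ?thesis by (simp only: grassmann_double[OF c] add_0_left)
qed

text \<open>In the recursion v_(i+1) sends x_i x_(i+1) to x_i. The remainder contains x_(i+1)
  [v_(i+2), v_(i+1)], which is zero by the preceding annihilation lemma at index
  \<open>Suc i\<close>.\<close>

lemma bracket_pivot_Suc:
  assumes c: "CHAR('k::field) = 2"
  shows "bracket (pivot i) (pivot (Suc i)) (f :: 'k grassmann) = gen i * pivot (i + 2) f"
proof -
  have z: "gen (Suc i) * bracket (pivot (Suc (Suc i))) (pivot (Suc i)) f = 0"
    using gen_times_bracket_pivot_Suc[OF c, of "Suc i" f] by (simp add: bracket_commute)
  show ?thesis
    using z by (simp add: bracket_pivot_rec[OF c] derivation_mult[OF pivot_derivation[OF c]]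
        pivot_gen mult.assoc)
qed

text \<open>For n >= i + 2, v_n kills x_i x_(i+1), so the recursion merely puts x_i x_(i+1) in front
  of [v_(i+2), v_n]. At even distance this descent ends in [v_n, v_n] = 0.\<close>

lemma bracket_pivot_even:
  assumes c: "CHAR('k::field) = 2"
  shows "bracket (pivot i) (pivot (i + 2 * k)) (f :: 'k grassmann) = 0"
proof (induction k arbitrary: i)
  case 0
  then show ?case by (simp add: bracket_self[OF c])
next
  case (Suc k)
  then show ?case
    using Suc[of "i + 2"]
    by (subst bracket_pivot_rec[OF c])
       (simp_all add: derivation_mult[OF pivot_derivation[OF c]] pivot_gen)
qed

lemma mon_atLeastLessThan_rec:
  assumes "i + 2 \<le> n"
  shows "gen i * gen (i + 1) * mon {i + 2..<n} = mon {i..<n}"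
proof -
  have "{i..<n} = insert i (insert (i + 1) {i + 2..<n})" using assms by auto
  then show ?thesis by (simp add: mon_def mult.assoc)
qed

text \<open>The same descent at odd distance ends at neighbouring pivots; the accumulated pairs of
  letters and the last single letter fill the interval.\<close>

lemma bracket_pivot_odd:
  assumes c: "CHAR('k::field) = 2"
  shows "bracket (pivot i) (pivot (i + 2 * k + 1)) (f :: 'k grassmann)
    = mon {i..<i + 2 * k + 1} * pivot (i + 2 * k + 2) f"
proof (induction k arbitrary: i)
  case 0
  have "{i..<Suc i} = {i}" by auto
  then show ?case using bracket_pivot_Suc[OF c, of i f] by (simp add: mon_singleton)
next
  case (Suc k)
  have "bracket (pivot i) (pivot (i + 2 * Suc k + 1)) f
      = gen i * gen (i + 1) * bracket (pivot (i + 2)) (pivot (i + 2 + 2 * k + 1)) f"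
    by (subst bracket_pivot_rec[OF c])
       (simp_all add: derivation_mult[OF pivot_derivation[OF c]] pivot_gen)
  also have "\<dots> = gen i * gen (i + 1) * mon {i + 2..<i + 2 + 2 * k + 1} * pivot (i + 2 + 2 * k + 2) f"
    by (simp only: Suc.IH mult.assoc)
  also have "gen i * gen (i + 1) * mon {i + 2..<i + 2 + 2 * k + 1} = (mon {i..<i + 2 + 2 * k + 1} :: 'k grassmann)"
    by (rule mon_atLeastLessThan_rec) simp
  finally show ?case by (simp add: add_ac)
qed

section \<open>Weights\<close>

text \<open>The degree of \<open>v\<^sub>n\<close> in the generators, since \<open>v\<^bsub>n+2\<^esub> = [v\<^sub>n, [v\<^sub>n, v\<^bsub>n+1\<^esub>]]\<close>.\<close>

fun jacobsthal :: "nat \<Rightarrow> nat" where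
  "jacobsthal 0 = 1"
| "jacobsthal (Suc 0) = 1"
| "jacobsthal (Suc (Suc n)) = jacobsthal (Suc n) + 2 * jacobsthal n"

abbreviation wt :: "nat set \<Rightarrow> nat" where
  "wt A \<equiv> sum jacobsthal A"

lemma jacobsthal_pos: "1 \<le> jacobsthal n"
  by (induction n rule: jacobsthal.induct) auto

lemma jacobsthal_strict_mono:
  assumes "1 \<le> m" "m < n"
  shows "jacobsthal m < jacobsthal n"
  using assms(2,1)
proof (induction rule: less_Suc_induct)
  case (1 i)
  then obtain j where "i = Suc j" by (cases i) auto
  then show ?case using jacobsthal_pos[of j] by simp
qed simp

text \<open>This makes all summands of v_i homogeneous of one degree: trading x_(i+2k) for x_i ...
  x_(i+2k-1) lowers the weight by exactly a_i. The recursion a_(n+2) = (a_n + a_(n+1)) + a_n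
  telescopes.\<close>

lemma wt_interval: "wt {i..<i + 2 * k} + jacobsthal i = jacobsthal (i + 2 * k)"
  by (induction k) simp_all

text \<open>In a_(n+2) = a_(n+1) + a_n + a_n one copy of a_n dominates all indices below n. The
  weights are thus almost superincreasing, which is the source of the bound 2.\<close>

lemma wt_lessThan_le: "wt {..<n} \<le> jacobsthal n"
  by (induction n rule: jacobsthal.induct) (simp_all add: lessThan_Suc)

lemma wt_eq_0: "finite A \<Longrightarrow> wt A = 0 \<Longrightarrow> A = {}"
  using sum_eq_0_iff[of A jacobsthal] jacobsthal_pos by (metis equals0I not_one_le_zero)

lemma wt_full:
  assumes "A \<subseteq> {..<n}" "wt {..<n} \<le> wt A"
  shows "A = {..<n}"
proof -
  have "wt {..<n} = wt A + wt ({..<n} - A)"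
    using sum.subset_diff[OF assms(1), of jacobsthal] by simp
  then have "{..<n} - A = {}" using assms(2) by (intro wt_eq_0) auto
  then show ?thesis using assms(1) by auto
qed

section \<open>Counting index sets of a given weight\<close>

definition subsets_of_wt :: "nat \<Rightarrow> nat \<Rightarrow> nat set set" where
  "subsets_of_wt k s = {A. A \<subseteq> {..<k} \<and> wt A = s}"

lemma finite_subsets_of_wt: "finite (subsets_of_wt k s)"
  unfolding subsets_of_wt_def by (rule finite_subset[of _ "Pow {..<k}"]) auto

lemma subsets_of_wt_le:
  assumes "A \<in> subsets_of_wt k s"
  shows "s \<le> wt {..<k}"
  using assms sum_mono2[of "{..<k}" A jacobsthal] by (simp add: subsets_of_wt_def)

lemma subsets_of_wt_0: "subsets_of_wt k 0 = {{}}"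
proof -
  have "A = {}" if "A \<in> subsets_of_wt k 0" for A
  proof (rule wt_eq_0)
    show "finite A" "wt A = 0"
      using that finite_subset[of A "{..<k}"] by (simp_all add: subsets_of_wt_def)
  qed
  moreover have "{} \<in> subsets_of_wt k 0" by (simp add: subsets_of_wt_def)
  ultimately show ?thesis by blast
qed

lemma subsets_of_wt_max: "wt {..<k} \<le> s \<Longrightarrow> subsets_of_wt k s \<subseteq> {{..<k}}"
  using wt_full by (auto simp: subsets_of_wt_def)

lemma subsets_of_wt_Suc:
  "subsets_of_wt (Suc k) s \<subseteq> subsets_of_wt k s \<union>
    (if jacobsthal k \<le> s then insert k ` subsets_of_wt k (s - jacobsthal k) else {})"
proof
  fix A assume "A \<in> subsets_of_wt (Suc k) s"
  then have A: "A \<subseteq> {..<Suc k}" "wt A = s" by (simp_all add: subsets_of_wt_def)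
  show "A \<in> subsets_of_wt k s \<union>
    (if jacobsthal k \<le> s then insert k ` subsets_of_wt k (s - jacobsthal k) else {})"
  proof (cases "k \<in> A")
    case True
    have fA: "finite A" by (rule finite_subset[OF A(1)]) simp
    have sA: "A - {k} \<subseteq> {..<k}" using A(1) by (auto simp: lessThan_Suc)
    have w: "s = jacobsthal k + wt (A - {k})"
      using sum.remove[OF fA True, of jacobsthal] unfolding A(2) .
    then have "A - {k} \<in> subsets_of_wt k (s - jacobsthal k)"
      using sA by (simp add: subsets_of_wt_def)
    then have "insert k (A - {k}) \<in> insert k ` subsets_of_wt k (s - jacobsthal k)"
      by (rule imageI)
    then show ?thesis using w by (simp add: insert_absorb[OF True])
  next
    case False
    then have "A \<subseteq> {..<k}" using A(1) by (auto simp: lessThan_Suc)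
    then show ?thesis using A(2) by (simp add: subsets_of_wt_def)
  qed
qed

text \<open>Decide whether the largest allowed index k belongs to the set. For s < a_k it cannot;
  for s > a_k it must, as all smaller indices together weigh at most a_k. For s = a_k each
  alternative leaves at most one set, \<open>{k}\<close> or \<open>{..<k}\<close>.\<close>

lemma card_subsets_of_wt: "card (subsets_of_wt k s) \<le> 2"
proof (induction k arbitrary: s)
  case 0
  have "card (subsets_of_wt 0 s) \<le> card {{} :: nat set}"
    by (rule card_mono) (auto simp: subsets_of_wt_def)
  then show ?case by simp
next
  case (Suc k)
  consider "s < jacobsthal k" | "s > jacobsthal k" | "s = jacobsthal k" by linarith
  then show ?case
  proof cases
    case 1
    then have "subsets_of_wt (Suc k) s \<subseteq> subsets_of_wt k s"
      using subsets_of_wt_Suc[of k s] by simp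
    then have "card (subsets_of_wt (Suc k) s) \<le> card (subsets_of_wt k s)"
      by (rule card_mono[OF finite_subsets_of_wt])
    then show ?thesis using Suc.IH[of s] by linarith
  next
    case 2
    then have "subsets_of_wt k s = {}"
      using subsets_of_wt_le[of _ k s] wt_lessThan_le[of k] by fastforce
    then have "subsets_of_wt (Suc k) s \<subseteq> insert k ` subsets_of_wt k (s - jacobsthal k)"
      using subsets_of_wt_Suc[of k s] 2 by simp
    then have "card (subsets_of_wt (Suc k) s) \<le> card (subsets_of_wt k (s - jacobsthal k))"
      by (rule surj_card_le[OF finite_subsets_of_wt])
    then show ?thesis using Suc.IH[of "s - jacobsthal k"] by linarith
  next
    case 3
    have "subsets_of_wt (Suc k) s \<subseteq> {{..<k}, {k}}"
      using subsets_of_wt_Suc[of k s] subsets_of_wt_max[of k s] wt_lessThan_le[of k]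
      by (auto simp: 3 subsets_of_wt_0)
    then have "card (subsets_of_wt (Suc k) s) \<le> card {{..<k}, {k}}" by (intro card_mono) auto
    also have "\<dots> \<le> 2" by (simp add: card_insert_if)
    finally show ?thesis .
  qed
qed

text \<open>The index set of the monomials \<open>x\<^sub>A v\<^sub>n\<close> of degree \<open>m\<close>; truncation makes \<open>A\<close> empty for \<open>n = 0\<close>.\<close>

definition monomial_index :: "nat \<Rightarrow> (nat \<times> nat set) set" where
  "monomial_index m = {(n, A). A \<subseteq> {..<n - 1} \<and> wt A + m = jacobsthal n}"

text \<open>With n' = k + 1, the degree is at most a_n by the first monomial and at least a_(k+1) -
  (a_0 + ... + a_(k-1)) >= a_k by the second. Strict growth from index 1 on forces k = n, and
  equality throughout then fixes both sets.\<close>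

lemma monomial_index_pair:
  assumes p: "(n, A) \<in> monomial_index m" and q: "(n', A') \<in> monomial_index m"
    and n: "1 \<le> n" "n < n'"
  shows "m = jacobsthal n" "A = {}" "n' = Suc n" "A' = {..<n}"
proof -
  obtain k where k: "n' = Suc k" using n by (cases n') auto
  have A: "A \<subseteq> {..<n - 1}" "wt A + m = jacobsthal n" and A': "A' \<subseteq> {..<k}" "wt A' + m = jacobsthal (Suc k)"
    using p q k by (auto simp: monomial_index_def)
  have le: "wt A' \<le> wt {..<k}" using sum_mono2[OF _ A'(1), of jacobsthal] by simp
  have s: "wt {..<k} + jacobsthal k \<le> jacobsthal (Suc k)" using wt_lessThan_le[of "Suc k"] by simp
  have "\<not> n < k" using jacobsthal_strict_mono[OF n(1), of k] le s A A' by linarith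
  then show e: "n' = Suc n" using k n by simp
  then have [simp]: "k = n" using k by simp
  show m: "m = jacobsthal n" using le s A A' by simp
  then show "A = {}" using A wt_eq_0[of A] finite_subset[of A "{..<n - 1}"] by simp
  show "A' = {..<n}" using wt_full[of A' n] A' le s m by simp
qed

text \<open>Degree 1 is exceptional because a_0 = a_1 = 1. An index above 1 would have to be 2 with
  the set \<open>{0}\<close>, but that monomial has degree 3 - 1 = 2.\<close>

lemma monomial_index_1: "monomial_index 1 \<subseteq> {(0, {}), (1, {})}"
proof
  fix p assume "p \<in> monomial_index 1"
  moreover obtain n A where "p = (n, A)" by (cases p)
  ultimately have p: "p = (n, A)" "(n, A) \<in> monomial_index 1" by simp_all
  have o: "(1, {}) \<in> monomial_index 1" by (simp add: monomial_index_def)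
  show "p \<in> {(0, {}), (1, {})}"
  proof (cases "n \<le> 1")
    case True
    then show ?thesis using p by (auto simp: monomial_index_def)
  next
    case False
    then have "n = Suc 1" "A = {..<1}" using monomial_index_pair[OF o p(2)] by simp_all
    then show ?thesis using p by (simp add: monomial_index_def lessThan_Suc eval_nat_numeral)
  qed
qed

lemma card_monomial_index: "finite (monomial_index m) \<and> card (monomial_index m) \<le> 2"
proof -
  have two: "finite S \<and> card S \<le> 2" if "S \<subseteq> {a, b}" for S :: "(nat \<times> nat set) set" and a b
  proof -
    have "card S \<le> card {a, b}" using that by (intro card_mono) auto
    also have "\<dots> \<le> 2" by (simp add: card_insert_if)
    finally show ?thesis using finite_subset[OF that] by simp
  qed
  consider "m = 1" | "monomial_index m = {}" | "m \<noteq> 1" "monomial_index m \<noteq> {}" by blast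
  then show ?thesis
  proof cases
    case 1
    then show ?thesis using two[OF monomial_index_1] by simp
  next
    case 2
    then show ?thesis by simp
  next
    case 3
    \<comment> \<open>Split at the least index: either a larger one also occurs and
      \<open>monomial_index_pair\<close> determines everything, or only \<open>n\<close> occurs and
      the sets of weight a_n - m are counted.\<close>
    define n where "n = (LEAST n. \<exists>A. (n, A) \<in> monomial_index m)"
    have "\<exists>n A. (n, A) \<in> monomial_index m" using 3(2) by auto
    then have "\<exists>A. (n, A) \<in> monomial_index m" unfolding n_def by (rule LeastI_ex)
    then obtain A where A: "(n, A) \<in> monomial_index m" by (rule exE)
    have least: "n \<le> n'" if "(n', A') \<in> monomial_index m" for n' A'
      unfolding n_def by (rule Least_le, rule exI, rule that)
    \<comment> \<open>Index 0 carries only the empty set, hence degree 1, which is excluded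
      here.\<close>
    have n1: "1 \<le> n" using A 3(1) by (cases n) (auto simp: monomial_index_def)
    show ?thesis
    proof (cases "\<exists>n' A'. (n', A') \<in> monomial_index m \<and> n < n'")
      case True
      then obtain n' A' where q: "(n', A') \<in> monomial_index m" "n < n'" by blast
      have "monomial_index m \<subseteq> {(n, {}), (Suc n, {..<n})}"
      proof
        fix p assume "p \<in> monomial_index m"
        moreover obtain l B where "p = (l, B)" by (cases p)
        ultimately have p: "p = (l, B)" "(l, B) \<in> monomial_index m" by simp_all
        then consider "l = n" | "n < l" using least[of l B] by linarith
        then show "p \<in> {(n, {}), (Suc n, {..<n})}"
        proof cases
          case 1
          then have "B = {}" using monomial_index_pair(2)[of n B m n' A'] p(2) q n1 by blast
          then show ?thesis using p(1) 1 by simp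
        next
          case 2
          then have "l = Suc n" "B = {..<n}" using monomial_index_pair[OF A p(2) n1] by blast+
          then show ?thesis using p(1) by simp
        qed
      qed
      then show ?thesis by (rule two)
    next
      case False
      let ?S = "subsets_of_wt (n - 1) (jacobsthal n - m)"
      have sub: "monomial_index m \<subseteq> Pair n ` ?S"
      proof
        fix p assume "p \<in> monomial_index m"
        moreover obtain l B where "p = (l, B)" by (cases p)
        ultimately have p: "p = (l, B)" "(l, B) \<in> monomial_index m" by simp_all
        then have "n \<le> l" "\<not> n < l" using least False by blast+
        then have "l = n" by simp
        then have "B \<subseteq> {..<n - 1}" "wt B + m = jacobsthal n" using p(2) by (auto simp: monomial_index_def)
        then have "B \<in> ?S" by (simp add: subsets_of_wt_def flip: add_implies_diff)
        then show "p \<in> Pair n ` ?S" using p(1) \<open>l = n\<close> by blast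
      qed
      have fin: "finite ?S" by (rule finite_subsets_of_wt)
      have "finite (monomial_index m)" by (rule finite_subset[OF sub finite_imageI[OF fin]])
      moreover have "card (monomial_index m) \<le> card ?S" by (rule surj_card_le[OF fin sub])
      ultimately show ?thesis using card_subsets_of_wt[of "n - 1" "jacobsthal n - m"] by linarith
    qed
  qed
qed

section \<open>The monomials span the commutators\<close>

definition pivot_monomial :: "nat \<times> nat set \<Rightarrow> 'k::field endo" where
  "pivot_monomial = (\<lambda>(n, A) f. mon A * pivot n f)"

definition monomial_space :: "nat \<Rightarrow> 'k::field endo set" where
  "monomial_space m = Endo.span (pivot_monomial ` monomial_index m)"

lemma mon_times_EndL: "T \<in> EndL \<Longrightarrow> (\<lambda>f. g * T f) \<in> EndL"
  by (rule EndL_I) (simp_all add: EndL_add EndL_scale distrib_left gscale_mult_right)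

lemma EndL_subspace: "Endo.subspace EndL"
  using lie_subalgebra_EndL unfolding lie_subalgebra_def by blast

lemma monomial_space_EndL: "monomial_space m \<subseteq> (EndL :: 'k::field endo set)"
  unfolding monomial_space_def
  by (rule Endo.span_minimal[OF _ EndL_subspace])
     (auto simp: pivot_monomial_def mon_times_EndL[OF pivot_in_EndL])

lemma subspace_monomial_space: "Endo.subspace (monomial_space m)"
  by (simp add: monomial_space_def)

lemma monomial_in_space:
  assumes "A \<subseteq> {..<n - 1}" "wt A + m = jacobsthal n"
  shows "(\<lambda>f. mon A * pivot n f) \<in> monomial_space m"
proof -
  have "pivot_monomial (n, A) \<in> monomial_space m"
    unfolding monomial_space_def
    by (rule Endo.span_base) (use assms in \<open>auto simp: monomial_index_def\<close>)
  then show ?thesis by (simp add: pivot_monomial_def)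
qed

text \<open>If the sets meet, the product is zero, so index bound and weight have to be checked for
  disjoint sets only.\<close>

lemma mon_product_in_space:
  assumes "finite A" "finite B"
    and "A \<inter> B = {} \<Longrightarrow> A \<union> B \<subseteq> {..<n - 1} \<and> wt A + wt B + m = jacobsthal n"
  shows "(\<lambda>f. mon A * mon B * pivot n f) \<in> monomial_space m"
proof (cases "A \<inter> B = {}")
  case True
  then show ?thesis
    using assms monomial_in_space[of "A \<union> B" n m] by (simp add: mon_mult sum.union_disjoint)
next
  case False
  then have "(\<lambda>f. mon A * mon B * pivot n f) = 0"
    using assms by (simp add: mon_mult fun_eq_iff)
  then show ?thesis using Endo.subspace_0[OF subspace_monomial_space] by metis
qed

text \<open>First Leibniz term of [v_i, x_A v_n]. The k-th summand of v_i replaces x_(i+2k) in x_A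
  by x_i ... x_(i+2k-1); this lowers the weight by a_i and brings in only smaller indices, so the
  bound on A persists.\<close>

lemma pivot_mon_in_space:
  assumes A: "A \<subseteq> {..<n - 1}" "wt A + m = jacobsthal n"
  shows "(\<lambda>f. pivot i (mon A) * pivot n f) \<in> monomial_space (m + jacobsthal i)"
proof -
  have fA: "finite A" using A(1) finite_subset by blast
  obtain N where N: "pivot i (mon A :: 'a grassmann)
      = (\<Sum>k<N. mon {i..<i + 2 * k} * partial (i + 2 * k) (mon A))"
    using pivot_as_sum by blast
  have sum_pointwise: "(\<lambda>f :: 'a grassmann. \<Sum>k<l. F k f) = (\<Sum>k<l. F k)"
    for l :: nat and F :: "nat \<Rightarrow> 'a endo"
    by (induction l) (auto simp: fun_eq_iff)
  have "(\<lambda>f :: 'a grassmann. pivot i (mon A) * pivot n f)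
    = (\<Sum>k<N. (\<lambda>f. mon {i..<i + 2 * k} * partial (i + 2 * k) (mon A) * pivot n f))"
    unfolding N sum_distrib_right sum_pointwise ..
  also have "\<dots> \<in> monomial_space (m + jacobsthal i)"
  proof (rule Endo.subspace_sum[OF subspace_monomial_space])
    fix k
    let ?j = "i + 2 * k"
    show "(\<lambda>f. mon {i..<?j} * partial ?j (mon A) * pivot n f)
      \<in> monomial_space (m + jacobsthal i)"
    proof (cases "?j \<in> A")
      case True
      have "wt {i..<?j} + wt (A - {?j}) + (m + jacobsthal i) = jacobsthal n"
        using wt_interval[of i k] sum.remove[OF fA True, of jacobsthal] A(2) by simp
      moreover have "{i..<?j} \<union> (A - {?j}) \<subseteq> {..<n - 1}" using A True by fastforce
      ultimately have "(\<lambda>f. mon {i..<?j} * mon (A - {?j}) * pivot n f)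
        \<in> monomial_space (m + jacobsthal i)"
        using fA by (intro mon_product_in_space) auto
      then show ?thesis using True by (simp add: partial_mon[OF fA])
    next
      case False
      then have "(\<lambda>f. mon {i..<?j} * partial ?j (mon A) * pivot n f) = 0"
        by (simp add: partial_mon[OF fA] fun_eq_iff)
      then show ?thesis using Endo.subspace_0[OF subspace_monomial_space] by metis
    qed
  qed
  finally show ?thesis .
qed

text \<open>Second Leibniz term. When [v_i, v_n] is x_i ... x_(n-1) v_(n+1), its letters reach n -
  1, exactly the bound allowed with v_(n+1). For i \<le> 1 the only case with n < i is
  [v_1, v_0].\<close>

lemma mon_bracket_in_space:
  assumes c: "CHAR('k::field) = 2"
    and A: "A \<subseteq> {..<n - 1}" "wt A + m = jacobsthal n" and i: "i \<le> 1"
  shows "(\<lambda>f :: 'k grassmann. mon A * bracket (pivot i) (pivot n) f) \<in> monomial_space (m + jacobsthal i)"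
proof -
  have fA: "finite A" using A(1) finite_subset by blast
  consider k where "n = i + 2 * k" | k where "n = i + 2 * k + 1" | "i = 1" "n = 0"
  proof (cases "i \<le> n")
    case True
    then have n: "n = i + (n - i)" by simp
    show thesis
    proof (cases "even (n - i)")
      case True
      then show thesis using that(1)[of "(n - i) div 2"] n by simp
    next
      case False
      then show thesis using that(2)[of "(n - i) div 2"] n
        by (metis add.assoc odd_two_times_div_two_succ)
    qed
  qed (use i that(3) in auto)
  then show ?thesis
  proof cases
    case 1
    then have "(\<lambda>f :: 'k grassmann. mon A * bracket (pivot i) (pivot n) f) = 0"
      by (simp add: bracket_pivot_even[OF c] fun_eq_iff)
    then show ?thesis using Endo.subspace_0[OF subspace_monomial_space] by metis
  next
    case (2 k)
    \<comment> \<open>\<open>wt_interval\<close> at \<open>Suc k\<close> concerns the interval up to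
      and including n; its last index n is split off.\<close>
    have "wt {i..<n} + jacobsthal n + jacobsthal i = jacobsthal (n + 1)"
      using wt_interval[of i "Suc k"] by (simp add: 2)
    then have "wt A + wt {i..<n} + (m + jacobsthal i) = jacobsthal (n + 1)" using A(2) by simp
    moreover have "A \<union> {i..<n} \<subseteq> {..<n + 1 - 1}" using A(1) by auto
    ultimately have "(\<lambda>f :: 'k grassmann. mon A * mon {i..<n} * pivot (n + 1) f)
      \<in> monomial_space (m + jacobsthal i)"
      using fA by (intro mon_product_in_space) auto
    then show ?thesis using bracket_pivot_odd[OF c, of i k] by (simp add: 2 mult.assoc)
  next
    case 3
    \<comment> \<open>For n = 0 the set A is empty and m = 1, while [v_1, v_0] = x_0 v_2.\<close>
    have "(\<lambda>f :: 'k grassmann. mon {0} * pivot 2 f) \<in> monomial_space (m + jacobsthal i)"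
      using 3 A by (intro monomial_in_space) (auto simp: eval_nat_numeral)
    then show ?thesis
      using 3 A bracket_pivot_Suc[OF c, of 0]
      by (simp add: bracket_commute[of "pivot (Suc 0)"] mon_singleton eval_nat_numeral)
  qed
qed

lemma bracket_in_subspace:
  assumes a: "a \<in> EndL" and V: "Endo.subspace V" and W: "\<And>w. w \<in> W \<Longrightarrow> bracket a w \<in> V"
    and x: "x \<in> Endo.span W"
  shows "bracket a x \<in> V"
  using x
proof (induction rule: Endo.span_induct_alt)
  case base
  have "a 0 = 0" using EndL_add[OF a, of 0 0] by simp
  then have "bracket a 0 = 0" by (simp add: fun_eq_iff bracket_apply)
  then show ?case using Endo.subspace_0[OF V] by (simp only:)
next
  case (step c x y)
  have "bracket a (escale c x + y) = escale c (bracket a x) + bracket a y"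
    by (simp add: fun_eq_iff bracket_apply escale_def EndL_add[OF a] EndL_scale[OF a]
        Grassmann.scale_right_distrib algebra_simps)
  then show ?case
    using Endo.subspace_add[OF V Endo.subspace_scale[OF V W[OF step.hyps(1)]] step.IH] by (simp only:)
qed

text \<open>The Leibniz rule splits [v_i, x_A v_n] into v_i(x_A) v_n and x_A [v_i, v_n]; both gain
  degree a_i, which is 1 for v_0 and v_1.\<close>

lemma bracket_pivot_space:
  assumes c: "CHAR('k::field) = 2" and i: "i \<le> 1" and w: "w \<in> monomial_space m"
  shows "bracket (pivot i) w \<in> (monomial_space (m + 1) :: 'k endo set)"
proof (rule bracket_in_subspace[OF pivot_in_EndL subspace_monomial_space])
  show "w \<in> Endo.span (pivot_monomial ` monomial_index m)"
    using w by (simp add: monomial_space_def)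
  fix u :: "'k endo" assume "u \<in> pivot_monomial ` monomial_index m"
  then obtain n A where A: "A \<subseteq> {..<n - 1}" "wt A + m = jacobsthal n"
    and u: "u = (\<lambda>f. mon A * pivot n f)"
    by (auto simp: monomial_index_def pivot_monomial_def)
  have "bracket (pivot i) u
    = (\<lambda>f. pivot i (mon A) * pivot n f) + (\<lambda>f. mon A * bracket (pivot i) (pivot n) f)"
    by (simp add: u fun_eq_iff bracket_apply derivation_mult[OF pivot_derivation[OF c]] algebra_simps)
  moreover have "jacobsthal i = 1" using i by (cases i) auto
  ultimately show "bracket (pivot i) u \<in> monomial_space (m + 1)"
    using pivot_mon_in_space[OF A, of i] mon_bracket_in_space[OF c A i]
    by (metis Endo.subspace_add[OF subspace_monomial_space])
qed

section \<open>From the two generators to arbitrary commutators\<close>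

lemma commutator_pos: "commutator n a \<Longrightarrow> 1 \<le> n"
  by (induction rule: commutator.induct) auto

lemma commutator_EndL: "commutator n a \<Longrightarrow> a \<in> EndL"
  by (induction rule: commutator.induct) (auto intro: pivot_in_EndL bracket_in_EndL)

lemma bracket_bracket:
  assumes c: "CHAR('k::field) = 2" and "a \<in> (EndL :: 'k endo set)" "b \<in> EndL" "w \<in> EndL"
  shows "bracket (bracket a b) w = bracket a (bracket b w) + bracket b (bracket a w)"
proof -
  have j: "bracket a (bracket b w) + bracket b (bracket a w) + bracket (bracket a b) w = (0 :: 'k endo)"
    using bracket_jacobi[OF assms] by (simp add: bracket_commute)
  show ?thesis
  proof
    fix f
    have "bracket a (bracket b w) f + bracket b (bracket a w) f + bracket (bracket a b) w f = 0"
      using fun_cong[OF j, of f] by simp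
    moreover have "bracket (bracket a b) w f + bracket (bracket a b) w f = 0"
      by (rule grassmann_double[OF c])
    ultimately show "bracket (bracket a b) w f
        = (bracket a (bracket b w) + bracket b (bracket a w)) f"
      by (metis add_right_cancel plus_fun_apply)
  qed
qed

text \<open>Stability is known under v_0 and v_1 only. The Jacobi identity expresses the action of a
  bracket through the actions of its factors, so induction reaches every bracketing.\<close>

lemma commutator_bracket_space:
  assumes c: "CHAR('k::field) = 2"
  shows "commutator m (a :: 'k endo) \<Longrightarrow> w \<in> monomial_space l
    \<Longrightarrow> bracket a w \<in> monomial_space (m + l)"
proof (induction arbitrary: w l rule: commutator.induct)
  case 1
  then show ?case using bracket_pivot_space[OF c, of 0 w l] by (simp add: add.commute)
next
  case 2
  then show ?case using bracket_pivot_space[OF c, of 1 w l] by (simp add: add.commute)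
next
  case (3 m a n b)
  have "w \<in> EndL" using 3 monomial_space_EndL by blast
  then have "bracket (bracket a b) w = bracket a (bracket b w) + bracket b (bracket a w)"
    using bracket_bracket[OF c commutator_EndL[OF 3(1)] commutator_EndL[OF 3(2)]] by blast
  moreover have "bracket a (bracket b w) \<in> monomial_space (m + n + l)"
    using 3 by (metis add.assoc)
  moreover have "bracket b (bracket a w) \<in> monomial_space (m + n + l)"
    using 3 by (metis add.assoc add.commute)
  ultimately show ?case using Endo.subspace_add[OF subspace_monomial_space] by (simp only:)
qed

lemma commutator_in_space:
  assumes c: "CHAR('k::field) = 2"
  shows "commutator m (a :: 'k endo) \<Longrightarrow> a \<in> monomial_space m"
proof (induction rule: commutator.induct)
  case 1
  then show ?case using monomial_in_space[of "{}" 0 1] by simp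
next
  case 2
  then show ?case using monomial_in_space[of "{}" 1 1] by simp
next
  case (3 m a n b)
  then show ?case using commutator_bracket_space[OF c] by blast
qed

lemma LieR_comp_dim:
  assumes c: "CHAR('k::field) = 2"
  shows "dim_at_most (LieR_comp n :: 'k endo set) 2"
proof -
  let ?W = "pivot_monomial ` monomial_index n :: 'k endo set"
  have sub: "LieR_comp n \<subseteq> Endo.span ?W"
    unfolding LieR_comp_def monomial_space_def[symmetric]
    by (rule Endo.span_minimal[OF _ subspace_monomial_space]) (auto intro: commutator_in_space[OF c])
  have fin: "finite ?W" using card_monomial_index by blast
  have "Endo.dim (LieR_comp n :: 'k endo set) \<le> card ?W" by (rule Endo.dim_le_card[OF sub fin])
  also have "\<dots> \<le> 2"
    using card_image_le[of "monomial_index n" "pivot_monomial :: _ \<Rightarrow> 'k endo"] card_monomial_index[of n]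
    by linarith
  finally show ?thesis unfolding dim_at_most_def using sub fin by blast
qed

section \<open>The gradation\<close>

text \<open>The index is an integer because lowering may pass below 0, where the piece is zero;
  truncated subtraction would land in weight 0 instead.\<close>

definition graded_piece :: "int \<Rightarrow> 'k::field grassmann set" where
  "graded_piece w = {f. \<forall>A. coeff_of f A \<noteq> 0 \<longrightarrow> int (wt A) = w}"

text \<open>Letters carry the weight opposite to the pivots, so degree n means lowering the letter
  weight by n.\<close>

definition homogeneous :: "nat \<Rightarrow> 'k::field endo set" where
  "homogeneous n = {T \<in> EndL. \<forall>w. \<forall>f\<in>graded_piece w. T f \<in> graded_piece (w - int n)}"

lemma graded_piece_0: "0 \<in> graded_piece w"
  by (simp add: graded_piece_def coeff_zero)

lemma graded_piece_add: "f \<in> graded_piece w \<Longrightarrow> g \<in> graded_piece w \<Longrightarrow> f + g \<in> graded_piece w"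
  by (auto simp: graded_piece_def coeff_plus) (metis add_0)

lemma graded_piece_scale: "f \<in> graded_piece w \<Longrightarrow> gscale c f \<in> graded_piece w"
  by (auto simp: graded_piece_def coeff_gscale)

lemma graded_piece_sum: "(\<And>k. k \<in> S \<Longrightarrow> F k \<in> graded_piece w) \<Longrightarrow> sum F S \<in> graded_piece w"
  by (induction S rule: infinite_finite_induct) (auto intro: graded_piece_0 graded_piece_add)

lemma coeff_nonzero_finite: "coeff_of f A \<noteq> 0 \<Longrightarrow> finite A"
  using coeff_of[of f] by auto

lemma graded_piece_mon: "finite A \<Longrightarrow> mon A \<in> graded_piece (int (wt A))"
  by (auto simp: graded_piece_def coeff_mon)

lemma graded_piece_mult:
  assumes "f \<in> graded_piece w" "g \<in> graded_piece w'"
  shows "f * g \<in> graded_piece (w + w')"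
  unfolding graded_piece_def
proof (safe)
  fix A assume nz: "coeff_of (f * g) A \<noteq> 0"
  then have fA: "finite A" by (rule coeff_nonzero_finite)
  obtain B where B: "B \<in> Pow A" "coeff_of f B * coeff_of g (A - B) \<noteq> 0"
    using nz unfolding coeff_times by (rule sum.not_neutral_contains_not_neutral)
  then have "int (wt B) = w" "int (wt (A - B)) = w'" using assms by (auto simp: graded_piece_def)
  moreover have "wt A = wt (A - B) + wt B"
    using sum.subset_diff[of B A jacobsthal] B fA by auto
  ultimately show "int (wt A) = w + w'" by simp
qed

lemma graded_piece_partial:
  assumes "f \<in> graded_piece w"
  shows "partial i f \<in> graded_piece (w - int (jacobsthal i))"
  unfolding graded_piece_def
proof (safe)
  fix A assume nz: "coeff_of (partial i f) A \<noteq> 0"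
  then have "finite A" by (rule coeff_nonzero_finite)
  moreover have "i \<notin> A" "coeff_of f (insert i A) \<noteq> 0"
    using nz by (auto simp: coeff_partial split: if_splits)
  ultimately have "int (jacobsthal i + wt A) = w" using assms by (auto simp: graded_piece_def)
  then show "int (wt A) = w - int (jacobsthal i)" by simp
qed

lemma pivot_homogeneous: "pivot i \<in> homogeneous (jacobsthal i)"
  unfolding homogeneous_def
proof (safe)
  show "pivot i \<in> EndL" by (rule pivot_in_EndL)
  fix w and f :: "'a grassmann" assume f: "f \<in> graded_piece w"
  obtain N where N: "pivot i f = (\<Sum>k<N. mon {i..<i + 2 * k} * partial (i + 2 * k) f)"
    by (rule pivot_as_sum)
  show "pivot i f \<in> graded_piece (w - int (jacobsthal i))"
    unfolding N
  proof (rule graded_piece_sum)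
    fix k
    have "int (wt {i..<i + 2 * k}) + (w - int (jacobsthal (i + 2 * k))) = w - int (jacobsthal i)"
      using wt_interval[of i k] by linarith
    then show "mon {i..<i + 2 * k} * partial (i + 2 * k) f \<in> graded_piece (w - int (jacobsthal i))"
      using graded_piece_mult[OF graded_piece_mon graded_piece_partial[OF f]] by (metis finite_atLeastLessThan)
  qed
qed

lemma homogeneous_bracket:
  assumes "a \<in> homogeneous m" "b \<in> homogeneous n"
  shows "bracket a b \<in> homogeneous (m + n)"
  unfolding homogeneous_def
proof (safe)
  show "bracket a b \<in> EndL" using assms by (simp add: homogeneous_def bracket_in_EndL)
  fix w and f :: "'a grassmann" assume "f \<in> graded_piece w"
  then have "a (b f) \<in> graded_piece (w - int n - int m)" "b (a f) \<in> graded_piece (w - int m - int n)"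
    using assms by (auto simp: homogeneous_def)
  then show "bracket a b f \<in> graded_piece (w - int (m + n))"
    unfolding bracket_apply by (intro graded_piece_add) (simp_all add: algebra_simps)
qed

lemma subspace_homogeneous: "Endo.subspace (homogeneous n)"
proof (rule Endo.subspaceI)
  show "0 \<in> homogeneous n"
    using Endo.subspace_0[OF EndL_subspace] by (simp add: homogeneous_def graded_piece_0)
  show "a + b \<in> homogeneous n" if "a \<in> homogeneous n" "b \<in> homogeneous n" for a b :: "'a endo"
    using that Endo.subspace_add[OF EndL_subspace, of a b]
    by (simp add: homogeneous_def graded_piece_add)
  show "escale c a \<in> homogeneous n" if "a \<in> homogeneous n" for c and a :: "'a endo"
    using that Endo.subspace_scale[OF EndL_subspace]
    by (auto simp: homogeneous_def graded_piece_scale) (simp add: escale_def graded_piece_scale)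
qed

lemma LieR_comp_homogeneous: "LieR_comp n \<subseteq> homogeneous n"
  unfolding LieR_comp_def
proof (rule Endo.span_minimal[OF _ subspace_homogeneous], safe)
  fix a :: "'a endo" assume "commutator n a"
  then show "a \<in> homogeneous n"
  proof (induction rule: commutator.induct)
    case 1
    then show ?case using pivot_homogeneous[of 0] by simp
  next
    case 2
    then show ?case using pivot_homogeneous[of 1] by simp
  next
    case (3 m a n b)
    then show ?case by (simp add: homogeneous_bracket)
  qed
qed

section \<open>Uniqueness of the homogeneous decomposition\<close>

lemma EndL_eqI:
  assumes "S \<in> EndL" "T \<in> EndL" and eq: "\<And>A. finite A \<Longrightarrow> S (mon A) = T (mon A)"
  shows "S = T"
proof
  fix f
  interpret S: Vector_Spaces.linear gscale gscale S using assms(1) by (simp add: EndL_def)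
  interpret T: Vector_Spaces.linear gscale gscale T using assms(2) by (simp add: EndL_def)
  show "S f = T f"
    by (subst (1 2) grassmann_expand[of f])
       (auto simp: S.sum T.sum S.scale T.scale eq[unfolded mon_def] coeff_nonzero_finite
         intro!: sum.cong)
qed

text \<open>The coefficient of x_B in the image of x_A can come only from the component of degree
  \<open>wt A - wt B\<close>; hence the sum determines every component.\<close>

lemma homogeneous_part_coeff:
  assumes r: "r 0 = 0" "\<And>n. n \<ge> 1 \<Longrightarrow> r n \<in> homogeneous n" "finite {n. r n \<noteq> 0}"
    and A: "finite A" and n: "1 \<le> n"
  shows "coeff_of (r n (mon A)) B = (if wt B + n = wt A then coeff_of (Sum_any r (mon A)) B else 0)"
proof -
  have nz: "wt B + k = wt A" if "coeff_of (r k (mon A)) B \<noteq> 0" for k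
  proof -
    have "k \<noteq> 0" using that r(1) by (metis coeff_zero zero_fun_apply)
    then have "r k (mon A) \<in> graded_piece (int (wt A) - int k)"
      using r(2)[of k] graded_piece_mon[OF A] by (auto simp: homogeneous_def)
    then have "int (wt B) = int (wt A) - int k" using that unfolding graded_piece_def by blast
    then show ?thesis by linarith
  qed
  show ?thesis
  proof (cases "wt B + n = wt A")
    case False
    then show ?thesis using nz[of n] by auto
  next
    case True
    have "coeff_of (sum r S (mon A)) B = (\<Sum>k\<in>S. coeff_of (r k (mon A)) B)" for S
      by (induction S rule: infinite_finite_induct) (auto simp: coeff_zero coeff_plus)
    then have "coeff_of (Sum_any r (mon A)) B = (\<Sum>k | r k \<noteq> 0. coeff_of (r k (mon A)) B)"
      by (simp add: Sum_any.expand_set)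
    also have "\<dots> = (\<Sum>k | r k \<noteq> 0. if k = n then coeff_of (r n (mon A)) B else 0)"
      by (rule sum.cong) (use nz True in force)+
    also have "\<dots> = coeff_of (r n (mon A)) B"
      using r(3) by (simp add: sum.delta' coeff_zero)
    finally show ?thesis using True by simp
  qed
qed

lemma homogeneous_decomposition_unique:
  assumes r: "r 0 = 0" "\<And>n. n \<ge> 1 \<Longrightarrow> r n \<in> homogeneous n" "finite {n. r n \<noteq> 0}"
    and s: "s 0 = 0" "\<And>n. n \<ge> 1 \<Longrightarrow> s n \<in> homogeneous n" "finite {n. s n \<noteq> 0}"
    and eq: "Sum_any r = Sum_any s"
  shows "r = s"
proof
  fix n
  show "r n = s n"
  proof (cases "n = 0")
    case False
    then have n: "1 \<le> n" by simp
    show ?thesis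
    proof (rule EndL_eqI)
      show "r n \<in> EndL" "s n \<in> EndL" using r(2)[OF n] s(2)[OF n] by (auto simp: homogeneous_def)
      show "r n (mon A) = s n (mon A)" if "finite A" for A
        by (rule grassmann_eqI)
           (simp only: homogeneous_part_coeff[OF r that n] homogeneous_part_coeff[OF s that n] eq)
    qed
  qed (simp add: r s)
qed

section \<open>Existence of the decomposition by commutator length\<close>

lemma commutator_LieR:
  assumes "commutator n a"
  shows "a \<in> LieR"
proof -
  have sub: "lie_subalgebra LieR" unfolding LieR_def
    by (rule lie_subalgebra_lie_generated) (auto intro: pivot_in_EndL)
  have gen: "pivot 0 \<in> LieR" "pivot 1 \<in> LieR" by (auto simp: LieR_def lie_generated_def)
  show ?thesis using assms
    by (induction rule: commutator.induct) (use gen sub in \<open>auto simp: lie_subalgebra_def\<close>)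
qed

text \<open>\<open>bracket_in_subspace\<close> gives linearity in the second argument; symmetry of
  the bracket transfers it to the first.\<close>

lemma bracket_span_in_subspace:
  assumes a: "a \<in> Endo.span S" and b: "b \<in> Endo.span T" and S: "S \<subseteq> EndL" and T: "T \<subseteq> EndL"
    and V: "Endo.subspace V" and st: "\<And>s t. s \<in> S \<Longrightarrow> t \<in> T \<Longrightarrow> bracket s t \<in> V"
  shows "bracket a b \<in> V"
proof (rule bracket_in_subspace[OF _ V _ b])
  show "a \<in> EndL" using a S Endo.span_minimal[OF _ EndL_subspace] by blast
  fix t assume t: "t \<in> T"
  have "bracket t a \<in> V"
    by (rule bracket_in_subspace[OF _ V _ a]) (use t T st in \<open>auto simp: bracket_commute[of t]\<close>)
  then show "bracket a t \<in> V" by (simp add: bracket_commute)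
qed

text \<open>By bilinearity the span of all commutators is a Lie subalgebra containing both
  generators, and \<open>LieR\<close> is the least such.\<close>

lemma LieR_subset_span: "LieR \<subseteq> Endo.span {a. \<exists>n. commutator n a}"
proof -
  let ?C = "{a :: 'a endo. \<exists>n. commutator n a}"
  have C: "?C \<subseteq> EndL" using commutator_EndL by blast
  have "lie_subalgebra (Endo.span ?C)"
    unfolding lie_subalgebra_def
  proof (intro conjI ballI)
    show "Endo.span ?C \<subseteq> EndL" by (rule Endo.span_minimal[OF C EndL_subspace])
    show "Endo.subspace (Endo.span ?C)" by simp
    fix a b assume "a \<in> Endo.span ?C" "b \<in> Endo.span ?C"
    then show "bracket a b \<in> Endo.span ?C"
      by (rule bracket_span_in_subspace[OF _ _ C C])
         (auto intro!: Endo.span_base intro: commutator.intros)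
  qed
  moreover have "{pivot 0, pivot 1} \<subseteq> ?C" using commutator.intros(1,2) by blast
  then have "{pivot 0, pivot 1} \<subseteq> Endo.span ?C" using Endo.span_superset by blast
  ultimately show ?thesis unfolding LieR_def lie_generated_def by blast
qed

lemma LieR_decomposition:
  assumes "a \<in> LieR"
  shows "\<exists>r. r 0 = 0 \<and> (\<forall>n\<ge>1. r n \<in> LieR_comp n) \<and> finite {n. r n \<noteq> 0} \<and> a = Sum_any r"
proof -
  have "a \<in> Endo.span {a. \<exists>n. commutator n a}" using assms LieR_subset_span by blast
  then show ?thesis
  proof (induction rule: Endo.span_induct_alt)
    case base
    have "(0 :: 'a endo) = Sum_any (\<lambda>_ :: nat. 0)" "finite {n :: nat. (0 :: 'a endo) \<noteq> 0}"
      by simp_all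
    moreover have "(0 :: 'a endo) \<in> LieR_comp n" for n
      unfolding LieR_comp_def by (rule Endo.span_zero)
    ultimately show ?case by (intro exI[of _ "\<lambda>_. 0"]) blast
  next
    case (step c x y)
    then obtain n r where n: "commutator n x" and r: "r 0 = 0" "\<And>k. k \<ge> 1 \<Longrightarrow> r k \<in> LieR_comp k"
      "finite {k. r k \<noteq> 0}" "y = Sum_any r" by blast
    \<comment> \<open>The new term is filed under its commutator length and added to what
      \<open>r\<close> already has there.\<close>
    let ?d = "\<lambda>k. if k = n then escale c x else 0"
    have fd: "finite {k. ?d k \<noteq> 0}" by (rule finite_subset[of _ "{n}"]) auto
    have d: "?d k \<in> LieR_comp k" for k
      using n by (auto simp: LieR_comp_def Endo.span_zero intro: Endo.span_scale Endo.span_base)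
    have "Sum_any (\<lambda>k. ?d k + r k) = escale c x + y"
      unfolding Sum_any.distrib[OF fd r(3)] r(4) by simp
    moreover have "finite {k. ?d k + r k \<noteq> 0}"
      by (rule finite_subset[OF _ finite_UnI[OF fd r(3)]]) auto
    moreover have "\<forall>k\<ge>1. ?d k + r k \<in> LieR_comp k"
      using d r(2) unfolding LieR_comp_def by (blast intro: Endo.span_add)
    \<comment> \<open>Commutators have length at least 1, so entry 0 stays zero.\<close>
    moreover have "?d 0 + r 0 = 0" using r(1) commutator_pos[OF n] by simp
    ultimately show ?case by (intro exI[of _ "\<lambda>k. ?d k + r k"]) (simp only: simp_thms)
  qed
qed

lemma graded_LieR: "graded_lie_algebra LieR LieR_comp"
  unfolding graded_lie_algebra_def
proof (intro conjI allI impI ballI)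
  show lie: "lie_subalgebra LieR" unfolding LieR_def
    by (rule lie_subalgebra_lie_generated) (auto intro: pivot_in_EndL)
  show "Endo.subspace (LieR_comp n)" for n by (simp add: LieR_comp_def)
  show "LieR_comp n \<subseteq> LieR" for n
    unfolding LieR_comp_def
    by (rule Endo.span_minimal) (use lie commutator_LieR in \<open>auto simp: lie_subalgebra_def\<close>)
  fix a :: "'a endo" assume "a \<in> LieR"
  then have "\<exists>r. r 0 = 0 \<and> (\<forall>n\<ge>1. r n \<in> LieR_comp n) \<and> finite {n. r n \<noteq> 0} \<and> a = Sum_any r"
    by (rule LieR_decomposition)
  moreover have "r = s"
    if "r 0 = 0 \<and> (\<forall>n\<ge>1. r n \<in> LieR_comp n) \<and> finite {n. r n \<noteq> 0} \<and> a = Sum_any r"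
      "s 0 = 0 \<and> (\<forall>n\<ge>1. s n \<in> LieR_comp n) \<and> finite {n. s n \<noteq> 0} \<and> a = Sum_any s"
    for r s
    by (rule homogeneous_decomposition_unique) (use that LieR_comp_homogeneous in auto)
  ultimately show "\<exists>!r. r 0 = 0 \<and> (\<forall>n\<ge>1. r n \<in> LieR_comp n) \<and> finite {n. r n \<noteq> 0} \<and> a = Sum_any r"
    by (rule ex_ex1I)
next
  fix m n and a b :: "'a endo" assume "a \<in> LieR_comp m" "b \<in> LieR_comp n"
  then show "bracket a b \<in> LieR_comp (m + n)"
    unfolding LieR_comp_def
    by (rule bracket_span_in_subspace)
       (auto intro!: Endo.span_base intro: commutator.intros commutator_EndL)
qed

section \<open>Width and the covering property\<close>

text \<open>A proper bracket has length at least 1 + 1, which leaves only the generators.\<close>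

lemma LieR_comp_1: "LieR_comp 1 = Endo.span {pivot 0, pivot 1}"
proof -
  have "a = pivot 0 \<or> a = pivot 1" if "commutator n a" "n = 1" for n and a :: "'a endo"
    using that
  proof cases
    case (3 k b l d)
    then show ?thesis using commutator_pos[of k b] commutator_pos[of l d] that(2) by linarith
  qed auto
  then have "{a :: 'a endo. commutator 1 a} = {pivot 0, pivot 1}"
    using commutator.intros(1,2) by blast
  then show ?thesis by (simp add: LieR_comp_def)
qed

text \<open>Test on x_0: v_0 sends it to 1, while v_1 kills it.\<close>

lemma pivot_0_not_span: "pivot 0 \<notin> Endo.span {pivot 1 :: 'k::field endo}"
proof
  assume "pivot 0 \<in> Endo.span {pivot 1 :: 'k endo}"
  then obtain c where "(pivot 0 :: 'k endo) = escale c (pivot 1)"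
    by (auto simp: Endo.span_singleton)
  then have "pivot 0 (gen 0 :: 'k grassmann) = gscale c (pivot 1 (gen 0))"
    by (simp add: escale_def)
  then show False by (simp add: pivot_gen)
qed

lemma dim_LieR_comp_1: "Endo.dim (LieR_comp 1 :: 'k::field endo set) = 2"
proof -
  have "pivot 1 (gen 1 :: 'k grassmann) \<noteq> 0" by (simp add: pivot_gen)
  then have nz: "pivot 1 \<noteq> (0 :: 'k endo)" by (metis zero_fun_apply)
  have "Endo.independent {pivot 0, pivot 1 :: 'k endo}"
    using pivot_0_not_span nz by (intro Endo.independent_insertI Endo.independent_empty) auto
  moreover have "(pivot 0 :: 'k endo) \<noteq> pivot 1"
    using pivot_0_not_span Endo.span_base by (metis singletonI)
  ultimately show ?thesis
    unfolding LieR_comp_1 by (subst Endo.dim_span_eq_card_independent) auto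
qed

text \<open>The monomial count gives the upper bound; it is attained in degree 1.\<close>

lemma width_LieR:
  assumes "CHAR('k::field) = 2"
  shows "has_width (LieR_comp :: nat \<Rightarrow> 'k endo set) 2"
  unfolding has_width_def
proof (intro conjI allI impI)
  show "dim_at_most (LieR_comp n :: 'k endo set) 2" for n by (rule LieR_comp_dim[OF assms])
  fix d assume "\<forall>n\<ge>1. dim_at_most (LieR_comp n :: 'k endo set) d"
  then have "dim_at_most (LieR_comp 1 :: 'k endo set) d" by blast
  then show "2 \<le> d" using dim_LieR_comp_1[where 'k = 'k] by (simp add: dim_at_most_def)
qed

lemma not_thin_LieR:
  assumes c: "CHAR('k::field) = 2"
  shows "\<not> thin (LieR_comp :: nat \<Rightarrow> 'k endo set)"
proof
  assume "thin (LieR_comp :: nat \<Rightarrow> 'k endo set)"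
  then have cov: "LieR_comp (n + 1) = (\<lambda>a. bracket a z) ` LieR_comp 1"
    if "n \<ge> 1" "z \<in> LieR_comp n" "z \<noteq> 0" for n and z :: "'k endo"
    using that by (simp add: thin_def)
  note P = derivation_mult[OF pivot_derivation[OF c]]
  let ?u = "bracket (pivot 0) (pivot 1) :: 'k endo"
  have u: "?u = (\<lambda>f. gen 0 * pivot 2 f)"
    using bracket_pivot_Suc[OF c, of 0] by (auto simp: eval_nat_numeral)
  have b02: "bracket (pivot 0) (pivot 2) f = (0 :: 'k grassmann)" for f
    using bracket_pivot_even[OF c, of 0 1 f] by (simp add: eval_nat_numeral)
  have b12: "bracket (pivot 1) (pivot 2) f = gen 1 * pivot 3 (f :: 'k grassmann)" for f
    using bracket_pivot_Suc[OF c, of 1 f] by (simp add: eval_nat_numeral)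
  have b13: "bracket (pivot 1) (pivot 3) f = (0 :: 'k grassmann)" for f
    using bracket_pivot_even[OF c, of 1 1 f] by (simp add: eval_nat_numeral)
  \<comment> \<open>Here v_0 strips x_0 from x_0 v_2, which yields v_2 in degree 3.\<close>
  have v2: "bracket (pivot 0) ?u = pivot 2"
  proof
    fix f
    have "bracket (pivot 0) ?u f = pivot 2 f + gen 0 * bracket (pivot 0) (pivot 2) f"
      unfolding u by (simp add: bracket_apply P pivot_gen algebra_simps)
    then show "bracket (pivot 0) ?u f = pivot 2 f" by (simp only: b02 mult_zero_right add_0_right)
  qed
  have y: "bracket (pivot 1) ?u = (\<lambda>f. gen 0 * gen 1 * pivot 3 f)"
  proof
    fix f
    have "bracket (pivot 1) ?u f = gen 0 * bracket (pivot 1) (pivot 2) f"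
      unfolding u by (simp add: bracket_apply P pivot_gen algebra_simps)
    then show "bracket (pivot 1) ?u f = gen 0 * gen 1 * pivot 3 f" by (simp only: b12 mult.assoc)
  qed
  \<comment> \<open>The first bracket with v_1 turned x_0 v_2 into x_0 x_1 v_3; the second strips
    x_1.\<close>
  have x: "bracket (pivot 1) (bracket (pivot 1) ?u) = (\<lambda>f. gen 0 * pivot 3 f)"
  proof
    fix f
    have "bracket (pivot 1) (bracket (pivot 1) ?u) f
        = gen 0 * pivot 3 f + gen 0 * gen 1 * bracket (pivot 1) (pivot 3) f"
      unfolding y by (simp add: bracket_apply P pivot_gen algebra_simps)
    then show "bracket (pivot 1) (bracket (pivot 1) ?u) f = gen 0 * pivot 3 f" by (simp only: b13 mult_zero_right add_0_right)
  qed
  have cu: "commutator 2 ?u"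
    using commutator.intros(3)[OF commutator.intros(1) commutator.intros(2)] by (simp add: eval_nat_numeral)
  have "commutator 3 (bracket (pivot 0) ?u)"
    using commutator.intros(3)[OF commutator.intros(1) cu] by (simp add: eval_nat_numeral)
  then have z: "pivot 2 \<in> (LieR_comp 3 :: 'k endo set)"
    unfolding v2 LieR_comp_def by (intro Endo.span_base) simp
  have "pivot 2 (gen 2 :: 'k grassmann) \<noteq> 0" by (simp add: pivot_gen)
  then have z0: "pivot 2 \<noteq> (0 :: 'k endo)" by (metis zero_fun_apply)
  have "commutator 3 (bracket (pivot 1) ?u)"
    using commutator.intros(3)[OF commutator.intros(2) cu] by (simp add: eval_nat_numeral)
  then have "commutator 4 (bracket (pivot 1) (bracket (pivot 1) ?u))"
    using commutator.intros(3)[OF commutator.intros(2), of 3] by (simp add: eval_nat_numeral)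
  then have "(\<lambda>f :: 'k grassmann. gen 0 * pivot 3 f) \<in> LieR_comp (3 + 1)"
    unfolding x LieR_comp_def by (intro Endo.span_base) simp
  then obtain a where a: "a \<in> LieR_comp 1" "(\<lambda>f :: 'k grassmann. gen 0 * pivot 3 f) = bracket a (pivot 2)"
    using cov[OF _ z z0] by auto
  let ?V = "Endo.span {\<lambda>f :: 'k grassmann. gen 1 * pivot 3 f}"
  \<comment> \<open>The arguments are swapped so that linearity in the second one reduces the claim
    to the generators, whose brackets with v_2 are 0 and x_1 v_3.\<close>
  have "bracket (pivot 2) a \<in> ?V"
  proof (rule bracket_in_subspace)
    show "a \<in> Endo.span {pivot 0, pivot 1}" using a(1) unfolding LieR_comp_1 .
    have "bracket (pivot 0) (pivot 2) = (0 :: 'k endo)"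
      "bracket (pivot 1) (pivot 2) = (\<lambda>f :: 'k grassmann. gen 1 * pivot 3 f)"
      using b02 b12 by (auto simp: fun_eq_iff)
    then show "bracket (pivot 2) w \<in> ?V" if "w \<in> {pivot 0, pivot 1}" for w
      using that bracket_commute[of "pivot 2" w] by (auto simp: Endo.span_zero intro: Endo.span_base)
  qed (simp_all add: pivot_in_EndL)
  then obtain d where "bracket (pivot 2) a = escale d (\<lambda>f :: 'k grassmann. gen 1 * pivot 3 f)"
    by (auto simp: Endo.span_singleton)
  then have "(\<lambda>f :: 'k grassmann. gen 0 * pivot 3 f) = escale d (\<lambda>f. gen 1 * pivot 3 f)"
    using a(2) bracket_commute[of a] by simp
  \<comment> \<open>At x_3, where v_3 gives 1, the equality becomes x_0 = d x_1, which the
    coefficient of x_0 refutes.\<close>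
  from fun_cong[OF this, of "gen 3"]
  have "gen 0 = gscale d (gen 1 :: 'k grassmann)" by (simp add: escale_def pivot_gen)
  then have "coeff_of (gen 0 :: 'k grassmann) {0} = d * coeff_of (gen 1) {0}"
    by (simp add: coeff_gscale)
  then show False by (simp add: coeff_gen)
qed

theorem corollary11p3:
  assumes "CHAR('k::field) = 2"
  shows "graded_lie_algebra (LieR :: 'k endo set) LieR_comp \<and>
    has_width (LieR_comp :: nat \<Rightarrow> 'k endo set) 2 \<and>
    \<not> thin (LieR_comp :: nat \<Rightarrow> 'k endo set)"
  using graded_LieR width_LieR[OF assms] not_thin_LieR[OF assms] by blast

end
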